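(* Let $G$ be a finite group. If $\mathrm{V}(\mathbb{Z}G)$ contains a subgroup isomorphic to $C_4 \times C_2$, then $G$ contains a subgroup isomorphic to $C_4 \times C_2$.
   Context: For a finite group $G$, $\mathbb{Z}G$ denotes the integral group ring and $\mathrm{V}(\mathbb{Z}G)$ denotes the group of normalized units of $\mathbb{Z}G$, i.e. the units $\sum_{g\in G} z_g g$ whose coefficients sum to $1$. $C_n$ denotes the cyclic group of order $n$. *)

theory Defs
  imports "HOL-Algebra.Algebra"
begin

text \<open>The integral group ring ZG of a finite group G: elements are integer-valued
functions on the carrier of G (zero outside the carrier), i.e. formal sums
sum_g z_g g, with convolution product.\<close>

definition group_ring_elems :: "('a, 'b) monoid_scheme \<Rightarrow> ('a \<Rightarrow> int) set" where
  "group_ring_elems G = {f. \<forall>x. x \<notin> carrier G \<longrightarrow> f x = 0}"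

definition group_ring_mult ::
  "('a, 'b) monoid_scheme \<Rightarrow> ('a \<Rightarrow> int) \<Rightarrow> ('a \<Rightarrow> int) \<Rightarrow> ('a \<Rightarrow> int)" where
  "group_ring_mult G f g =
     (\<lambda>x. if x \<in> carrier G
          then (\<Sum>y\<in>carrier G. f y * g (inv\<^bsub>G\<^esub> y \<otimes>\<^bsub>G\<^esub> x)) else 0)"

definition group_ring_one :: "('a, 'b) monoid_scheme \<Rightarrow> ('a \<Rightarrow> int)" where
  "group_ring_one G = (\<lambda>x. if x = \<one>\<^bsub>G\<^esub> then 1 else 0)"

definition augmentation :: "('a, 'b) monoid_scheme \<Rightarrow> ('a \<Rightarrow> int) \<Rightarrow> int" where
  "augmentation G f = (\<Sum>x\<in>carrier G. f x)"

definition normalized_units :: "('a, 'b) monoid_scheme \<Rightarrow> ('a \<Rightarrow> int) set" where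
  "normalized_units G =
     {u \<in> group_ring_elems G. augmentation G u = 1 \<and>
        (\<exists>v \<in> group_ring_elems G. group_ring_mult G u v = group_ring_one G
                                 \<and> group_ring_mult G v u = group_ring_one G)}"

definition V_ZG :: "('a, 'b) monoid_scheme \<Rightarrow> ('a \<Rightarrow> int) monoid" where
  "V_ZG G = \<lparr>carrier = normalized_units G, monoid.mult = group_ring_mult G,
             one = group_ring_one G\<rparr>"

definition C4xC2 :: "(int \<times> int) monoid" where
  "C4xC2 = integer_mod_group 4 \<times>\<times> integer_mod_group 2"

end

(* Let a, b generate C4 x C2 in V(ZG) and let c be a 2-element of maximal order 2^k in G. The operators
   m |-> a m, m |-> b m, m |-> m c on CG commute, so the trace of the projection onto each joint eigenspace
   is a natural number. 8 * 2^k times such a trace is a combination of the sums of the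
   coefficients of a^i b^j over conjugacy classes of powers of c, and these sums vanish whenever the order
   of the power of c does not divide that of a^i b^j. What remains yields a congruence for the order of G
   modulo a power of 2. If G had no subgroup C4 x C2, then the index of <c> would be odd, or twice an
   odd number with c^(2^(k-2)) conjugate to its inverse, and this contradicts the congruence. *)

theory Submission
  imports Defs
begin

text \<open>The sums vanish by divisibility. Up to the centraliser order, the class sum of u at h is
  the integer trace of T, left multiplication by u times right translation by h. If u^(2^s) = 1
  while h^(2^s) has even order, some diagonal sign matrix Q, so Q = 1 mod 2, anticommutes with
  T^(2^s); averaging over conjugates yields a Q = 1 mod 2 that anticommutes with T itself. Then
  Q^(2^m) T has trace 0 for every m, while Q^(2^m) = 1 mod 2^(m+1), so every power of 2 divides the
  trace of T. For a with eigenvalue i or -i and b with eigenvalue 1, the even powers of a contribute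
  |G| + w or |G| - w, depending on the eigenvalue of c; adding both cases removes the unknown w. The
  odd powers of a cancel between i and -i at the price of a factor 2, which is affordable for odd
  index. For index twice an odd number the full factor is needed: conjugacy of c^(2^(k-2)) to its
  inverse makes the odd part purely imaginary, so it vanishes because the traces are real. That
  power of c presupposes an element of order 4 in G, which a parity count of coefficients
  provides.\<close>

section \<open>Parity of sums and of fixed point counts\<close>

text \<open>Points moved by \<open>\<sigma>\<close> fall into pairs with equal values of
  \<open>f\<close>, and each pair contributes an even number.\<close>

lemma sum_involution_parity:
  fixes f :: "'x \<Rightarrow> int"
  assumes "finite S" "\<And>x. x \<in> S \<Longrightarrow> \<sigma> x \<in> S" "\<And>x. x \<in> S \<Longrightarrow> \<sigma> (\<sigma> x) = x"
    "\<And>x. x \<in> S \<Longrightarrow> f (\<sigma> x) = f x"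
  shows "even (sum f S) \<longleftrightarrow> even (\<Sum>x | x \<in> S \<and> \<sigma> x = x. f x)"
  using assms
proof (induction "card S" arbitrary: S rule: less_induct)
  case less
  show ?case
  proof (cases "\<exists>x\<in>S. \<sigma> x \<noteq> x")
    case False
    then have "{x \<in> S. \<sigma> x = x} = S" by auto
    then show ?thesis by simp
  next
    case True
    then obtain x where x: "x \<in> S" "\<sigma> x \<noteq> x" by blast
    define S' where "S' = S - {x, \<sigma> x}"
    have \<sigma>x: "\<sigma> x \<in> S" "\<sigma> (\<sigma> x) = x" using x less.prems by auto
    have S': "S = insert x (insert (\<sigma> x) S')" "x \<notin> S'" "\<sigma> x \<notin> S'" "finite S'"
      using x \<sigma>x less.prems(1) by (auto simp: S'_def)
    have "even (sum f S') \<longleftrightarrow> even (\<Sum>x | x \<in> S' \<and> \<sigma> x = x. f x)"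
    proof (rule less.hyps)
      show "card S' < card S" using S' x(2) by simp
      fix z assume z: "z \<in> S'"
      then have "z \<in> S" by (simp add: S'_def)
      note z' = less.prems(2-4)[OF this]
      show "\<sigma> (\<sigma> z) = z" "f (\<sigma> z) = f z" using z' by auto
      have "\<sigma> z \<noteq> x" "\<sigma> z \<noteq> \<sigma> x"
        using z S'(2,3) z'(2) \<sigma>x(2) by metis+
      then show "\<sigma> z \<in> S'" using z'(1) by (simp add: S'_def)
    qed (use S' in auto)
    moreover have "sum f S = sum f S' + 2 * f x"
      using S' x less.prems(4)[OF x(1)] by simp
    moreover have "{z \<in> S. \<sigma> z = z} = {z \<in> S'. \<sigma> z = z}"
      using S'(1) x(2) \<sigma>x(2) by auto
    ultimately show ?thesis by simp
  qed
qed

lemma card_involution_parity: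
  assumes "finite S" "\<And>x. x \<in> S \<Longrightarrow> \<sigma> x \<in> S" "\<And>x. x \<in> S \<Longrightarrow> \<sigma> (\<sigma> x) = x"
  shows "even (card S) \<longleftrightarrow> even (card {x \<in> S. \<sigma> x = x})"
  using sum_involution_parity[of S \<sigma> "\<lambda>_. 1"] assms by simp

text \<open>Orbits of a permutation of 2-power order have length 1 or even length. In the induction
  \<open>f ^^ (2 ^ n)\<close> is an involution on \<open>S\<close>, and on its fixed points
  \<open>f\<close> has exponent \<open>2 ^ n\<close>.\<close>

lemma card_fixed_points_parity:
  assumes "finite S" "\<And>x. x \<in> S \<Longrightarrow> f x \<in> S" "\<And>x. x \<in> S \<Longrightarrow> (f ^^ (2 ^ n)) x = x"
  shows "even (card S) \<longleftrightarrow> even (card {x \<in> S. f x = x})"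
  using assms
proof (induction n arbitrary: S)
  case 0
  then have "{x \<in> S. f x = x} = S" by auto
  then show ?case by simp
next
  case (Suc n)
  define g where "g = f ^^ (2 ^ n)"
  define S' where "S' = {x \<in> S. g x = x}"
  have iter: "(f ^^ m) x \<in> S" if "x \<in> S" for x m
    using that Suc.prems(2) by (induction m) auto
  have "g (g x) = x" if "x \<in> S" for x
    using Suc.prems(3)[OF that] by (simp add: g_def mult_2 funpow_add)
  then have "even (card S) \<longleftrightarrow> even (card S')"
    unfolding S'_def using Suc.prems(1) iter by (intro card_involution_parity) (auto simp: g_def)
  also have "\<dots> \<longleftrightarrow> even (card {x \<in> S'. f x = x})"
  proof (rule Suc.IH)
    show "finite S'" using Suc.prems(1) by (simp add: S'_def)
    show "(f ^^ 2 ^ n) x = x" if "x \<in> S'" for x using that by (simp add: S'_def g_def)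
    show "f x \<in> S'" if "x \<in> S'" for x
    proof -
      have "g (f x) = f (g x)" by (simp add: g_def funpow_swap1)
      then show ?thesis using that Suc.prems(2) by (simp add: S'_def)
    qed
  qed
  also have "{x \<in> S'. f x = x} = {x \<in> S. f x = x}"
  proof -
    have "(f ^^ m) x = x" if "f x = x" for x m using that by (induction m) auto
    then show ?thesis by (auto simp: S'_def g_def)
  qed
  finally show ?case .
qed

section \<open>Traces of idempotents\<close>

text \<open>The number is the rank, obtained by Wedderburn rank reduction: subtracting column a
  times row b, divided by a nonzero entry \<open>f b a\<close>, leaves an idempotent, lowers the
  trace by 1 and clears column a. The clause on \<open>n = 0\<close> serves the extremal cases in
  \<open>involution_coeff_one\<close>.\<close>

lemma idempotent_kernel_trace:
  fixes f :: "'a \<Rightarrow> 'a \<Rightarrow> 'c::field"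
  assumes "finite A"
    and "\<And>i j. i \<in> A \<Longrightarrow> j \<in> A \<Longrightarrow> (\<Sum>k\<in>A. f i k * f k j) = f i j"
  shows "\<exists>n::nat. (\<Sum>i\<in>A. f i i) = of_nat n \<and> (n = 0 \<longrightarrow> (\<forall>i\<in>A. \<forall>j\<in>A. f i j = 0))"
  using assms(2)
proof (induction "card {j\<in>A. \<exists>i\<in>A. f i j \<noteq> 0}" arbitrary: f rule: less_induct)
  case less
  show ?case
  proof (cases "\<forall>i\<in>A. \<forall>j\<in>A. f i j = 0")
    case True
    then show ?thesis by (intro exI[of _ 0]) auto
  next
    case False
    then obtain a b where ab: "a \<in> A" "b \<in> A" "f b a \<noteq> 0" by blast
    define g where "g i j = f i j - f i a * f b j / f b a" for i j
    have s1: "(\<Sum>k\<in>A. f i a * f b k / f b a * f k j) = f i a * f b j / f b a"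
      if "i \<in> A" "j \<in> A" for i j
    proof -
      have "(\<Sum>k\<in>A. f i a * f b k / f b a * f k j) = f i a / f b a * (\<Sum>k\<in>A. f b k * f k j)"
        by (subst sum_distrib_left, rule sum.cong) auto
      then show ?thesis using less.prems[of b j] that ab by simp
    qed
    have s2: "(\<Sum>k\<in>A. f i k * (f k a * f b j / f b a)) = f i a * f b j / f b a"
      if "i \<in> A" "j \<in> A" for i j
    proof -
      have "(\<Sum>k\<in>A. f i k * (f k a * f b j / f b a)) = (\<Sum>k\<in>A. f i k * f k a) * (f b j / f b a)"
        by (subst sum_distrib_right, rule sum.cong) auto
      then show ?thesis using less.prems[of i a] that ab by simp
    qed
    have s3: "(\<Sum>k\<in>A. f i a * f b k / f b a * (f k a * f b j / f b a)) = f i a * f b j / f b a"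
      if "i \<in> A" "j \<in> A" for i j
    proof -
      have "(\<Sum>k\<in>A. f i a * f b k / f b a * (f k a * f b j / f b a))
         = f i a / f b a * (\<Sum>k\<in>A. f b k * f k a) * (f b j / f b a)"
        by (subst sum_distrib_left, subst sum_distrib_right, rule sum.cong) auto
      then show ?thesis using less.prems[of b a] that ab by simp
    qed
    have idem: "(\<Sum>k\<in>A. g i k * g k j) = g i j" if "i \<in> A" "j \<in> A" for i j
    proof -
      have "(\<Sum>k\<in>A. g i k * g k j) = (\<Sum>k\<in>A. f i k * f k j)
          - (\<Sum>k\<in>A. f i k * (f k a * f b j / f b a)) - (\<Sum>k\<in>A. f i a * f b k / f b a * f k j)
          + (\<Sum>k\<in>A. f i a * f b k / f b a * (f k a * f b j / f b a))"
        unfolding g_def left_diff_distrib right_diff_distrib sum_subtractf by simp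
      then show ?thesis using s1 s2 s3 less.prems that by (simp add: g_def)
    qed
    have "{j\<in>A. \<exists>i\<in>A. g i j \<noteq> 0} \<subset> {j\<in>A. \<exists>i\<in>A. f i j \<noteq> 0}"
    proof (rule psubsetI)
      show "{j\<in>A. \<exists>i\<in>A. g i j \<noteq> 0} \<subseteq> {j\<in>A. \<exists>i\<in>A. f i j \<noteq> 0}"
      proof (clarify)
        fix i j assume ij: "i \<in> A" "j \<in> A" "g i j \<noteq> 0"
        then have "f i j \<noteq> 0 \<or> f b j \<noteq> 0" by (auto simp: g_def)
        then show "\<exists>i\<in>A. f i j \<noteq> 0" using ij ab by blast
      qed
      have "a \<in> {j\<in>A. \<exists>i\<in>A. f i j \<noteq> 0}" using ab by blast
      moreover have "a \<notin> {j\<in>A. \<exists>i\<in>A. g i j \<noteq> 0}" using ab by (auto simp: g_def)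
      ultimately show "{j\<in>A. \<exists>i\<in>A. g i j \<noteq> 0} \<noteq> {j\<in>A. \<exists>i\<in>A. f i j \<noteq> 0}" by blast
    qed
    then have "card {j\<in>A. \<exists>i\<in>A. g i j \<noteq> 0} < card {j\<in>A. \<exists>i\<in>A. f i j \<noteq> 0}"
      using assms(1) by (intro psubset_card_mono) auto
    from less.hyps[OF this idem] obtain n :: nat where n: "(\<Sum>i\<in>A. g i i) = of_nat n" by blast
    have "(\<Sum>i\<in>A. f i a * f b i / f b a) = (\<Sum>i\<in>A. f b i * f i a) / f b a"
      by (subst sum_divide_distrib, rule sum.cong) auto
    also have "\<dots> = 1" using less.prems[of b a] ab by simp
    finally have "(\<Sum>i\<in>A. f i i) = of_nat (Suc n)"
      using n by (simp add: g_def sum_subtractf algebra_simps)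
    then show ?thesis by blast
  qed
qed

section \<open>Linear operators on functions and their traces\<close>

text \<open>As a type, operators form an instance of \<open>ring_1\<close>, so powers, finite sums
  and ring simplification are available. They act on functions on the whole type because the carrier
  of a group is a set; support on \<open>A\<close> is tracked by \<open>preserves\<close> and
  \<open>tr A\<close>.\<close>

typedef (overloaded) ('a, 'c::comm_ring_1) linop =
  "{F :: ('a \<Rightarrow> 'c) \<Rightarrow> 'a \<Rightarrow> 'c. (\<forall>x y. F (\<lambda>i. x i + y i) = (\<lambda>i. F x i + F y i)) \<and>
      (\<forall>c x. F (\<lambda>i. c * x i) = (\<lambda>i. c * F x i))}"
  morphisms app_op Abs_linop
  by (rule exI[of _ "\<lambda>x. x"]) auto

setup_lifting type_definition_linop

instantiation linop :: (type, comm_ring_1) ring_1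
begin

lift_definition zero_linop :: "('a, 'b) linop" is "\<lambda>x i. 0" by auto
lift_definition one_linop :: "('a, 'b) linop" is "\<lambda>x. x" by auto
lift_definition plus_linop :: "('a, 'b) linop \<Rightarrow> ('a, 'b) linop \<Rightarrow> ('a, 'b) linop"
  is "\<lambda>F G x i. F x i + G x i"
  by (auto simp: fun_eq_iff algebra_simps)
lift_definition uminus_linop :: "('a, 'b) linop \<Rightarrow> ('a, 'b) linop"
  is "\<lambda>F x i. - F x i"
  by (auto simp: fun_eq_iff algebra_simps)
lift_definition minus_linop :: "('a, 'b) linop \<Rightarrow> ('a, 'b) linop \<Rightarrow> ('a, 'b) linop"
  is "\<lambda>F G x i. F x i - G x i"
  by (auto simp: fun_eq_iff algebra_simps)
lift_definition times_linop :: "('a, 'b) linop \<Rightarrow> ('a, 'b) linop \<Rightarrow> ('a, 'b) linop"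
  is "\<lambda>F G x. F (G x)"
  by simp

instance
proof
  fix F G H :: "('a, 'b) linop"
  show "F * (G + H) = F * G + F * H"
    by transfer (auto simp: fun_eq_iff)
  show "(0::('a, 'b) linop) \<noteq> 1"
    by transfer (auto simp: fun_eq_iff intro!: exI[of _ "\<lambda>_. 1"])
qed (transfer; auto simp: fun_eq_iff algebra_simps)+

end

lift_definition diag_op :: "('a \<Rightarrow> 'c::comm_ring_1) \<Rightarrow> ('a, 'c) linop"
  is "\<lambda>d x i. d i * x i"
  by (auto simp: fun_eq_iff algebra_simps)

abbreviation scal_op :: "'c::comm_ring_1 \<Rightarrow> ('a, 'c) linop" where
  "scal_op c \<equiv> diag_op (\<lambda>_. c)"

definition unit_vec :: "'a \<Rightarrow> 'a \<Rightarrow> 'c::comm_ring_1" where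
  "unit_vec i = (\<lambda>j. if j = i then 1 else 0)"

text \<open>For operators with this property the A x A block of a product is the product of the
  blocks, so \<open>tr A\<close> behaves like the trace of a matrix.\<close>

definition preserves :: "'a set \<Rightarrow> ('a, 'c::comm_ring_1) linop \<Rightarrow> bool" where
  "preserves A F \<longleftrightarrow> (\<forall>x. (\<forall>i. i \<notin> A \<longrightarrow> x i = 0) \<longrightarrow> (\<forall>i. i \<notin> A \<longrightarrow> app_op F x i = 0))"

definition tr :: "'a set \<Rightarrow> ('a, 'c::comm_ring_1) linop \<Rightarrow> 'c" where
  "tr A F = (\<Sum>i\<in>A. app_op F (unit_vec i) i)"

lemmas app_op_simps = zero_linop.rep_eq one_linop.rep_eq plus_linop.rep_eq uminus_linop.rep_eq
  minus_linop.rep_eq times_linop.rep_eq diag_op.rep_eq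

lemma app_op_add: "app_op F (\<lambda>i. x i + y i) = (\<lambda>i. app_op F x i + app_op F y i)"
  and app_op_cmult: "app_op F (\<lambda>i. c * x i) = (\<lambda>i. c * app_op F x i)"
  using app_op[of F] by auto

lemma app_op_zero: "app_op F (\<lambda>_. 0) = (\<lambda>_. 0)"
  using app_op_cmult[of F 0] by simp

lemma app_op_sum:
  assumes "finite B"
  shows "app_op F (\<lambda>i. \<Sum>b\<in>B. x b i) = (\<lambda>i. \<Sum>b\<in>B. app_op F (x b) i)"
  using assms by induction (simp_all add: app_op_zero app_op_add)

lemma linop_eqI: "(\<And>x i. app_op F x i = app_op G x i) \<Longrightarrow> F = G"
  by (metis app_op_inject ext)

lemma scal_op_commute: "F * scal_op c = scal_op c * F"
  by (rule linop_eqI) (simp add: app_op_simps app_op_cmult)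

lemma scal_op_hom [simp]: "scal_op 0 = 0" "scal_op 1 = 1"
  "scal_op a * scal_op b = scal_op (a * b)" "scal_op a + scal_op b = scal_op (a + b)"
  by (auto intro!: linop_eqI simp: app_op_simps algebra_simps)

lemma of_nat_eq_scal_op: "of_nat n = scal_op (of_nat n)"
  by (induction n) (auto intro!: linop_eqI simp: app_op_simps algebra_simps)

lemma app_op_expand:
  assumes "finite A" "\<And>i. i \<notin> A \<Longrightarrow> x i = 0"
  shows "app_op F x i = (\<Sum>k\<in>A. x k * app_op F (unit_vec k) i)"
proof -
  have "x = (\<lambda>i. \<Sum>k\<in>A. x k * unit_vec k i)"
    using assms by (auto simp: unit_vec_def fun_eq_iff if_distrib[of "\<lambda>t. _ * t"] cong: if_cong)
  then have "app_op F x = app_op F (\<lambda>i. \<Sum>k\<in>A. x k * unit_vec k i)" by simp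
  then show ?thesis using assms(1) by (simp add: app_op_sum app_op_cmult)
qed

lemma preserves_unit:
  "preserves A F \<Longrightarrow> k \<in> A \<Longrightarrow> i \<notin> A \<Longrightarrow> app_op F (unit_vec k) i = 0"
  unfolding preserves_def by (metis (full_types) unit_vec_def)

lemma preserves_simps [intro, simp]:
  "preserves A 0" "preserves A 1" "preserves A (diag_op d)"
  "preserves A F \<Longrightarrow> preserves A G \<Longrightarrow> preserves A (F + G)"
  "preserves A F \<Longrightarrow> preserves A G \<Longrightarrow> preserves A (F - G)"
  "preserves A F \<Longrightarrow> preserves A G \<Longrightarrow> preserves A (F * G)"
  "preserves A F \<Longrightarrow> preserves A (- F)"
  by (auto simp: preserves_def app_op_simps)

lemma preserves_power [intro, simp]: "preserves A F \<Longrightarrow> preserves A (F ^ n)"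
  by (induction n) auto

lemma preserves_of_nat [intro, simp]: "preserves A (of_nat n)" "preserves A (numeral w)"
  by (metis of_nat_eq_scal_op preserves_simps(3)) (metis of_nat_eq_scal_op of_nat_numeral preserves_simps(3))

lemma preserves_sum [intro, simp]: "(\<And>i. i \<in> I \<Longrightarrow> preserves A (F i)) \<Longrightarrow> preserves A (sum F I)"
  by (induction I rule: infinite_finite_induct) auto

lemma tr_add: "tr A (F + G) = tr A F + tr A G"
  and tr_diff: "tr A (F - G) = tr A F - tr A G"
  and tr_uminus: "tr A (- F) = - tr A F"
  and tr_zero: "tr A 0 = 0"
  and tr_scal: "tr A (scal_op c * F) = c * tr A F"
  by (simp_all add: tr_def app_op_simps sum.distrib sum_subtractf sum_negf sum_distrib_left)

lemma tr_one: "finite A \<Longrightarrow> tr A 1 = of_nat (card A)"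
  by (simp add: tr_def app_op_simps unit_vec_def)

lemma tr_sum: "tr A (sum F I) = (\<Sum>i\<in>I. tr A (F i))"
  by (induction I rule: infinite_finite_induct) (auto simp: tr_add tr_zero)

definition proj :: "'a set \<Rightarrow> ('a, 'c::comm_ring_1) linop" where
  "proj A = diag_op (\<lambda>i. if i \<in> A then 1 else 0)"

text \<open>\<open>tr A\<close> evaluates operators only on functions supported on \<open>A\<close>.
  Operator identities that hold on these functions, expressed by a factor \<open>proj A\<close>,
  therefore suffice for traces.\<close>

lemma tr_mult_proj:
  fixes F :: "('a, 'c::comm_ring_1) linop"
  shows "tr A (F * proj A) = tr A F"
proof -
  have "app_op (proj A) (unit_vec i) = (unit_vec i :: 'a \<Rightarrow> 'c)" if "i \<in> A" for i
    using that by (auto simp: proj_def app_op_simps unit_vec_def fun_eq_iff)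
  then show ?thesis by (simp add: tr_def app_op_simps)
qed

lemma tr_mult:
  assumes "finite A" "preserves A G"
  shows "tr A (F * G) = (\<Sum>i\<in>A. \<Sum>k\<in>A. app_op G (unit_vec i) k * app_op F (unit_vec k) i)"
  unfolding tr_def
  by (intro sum.cong refl, simp add: app_op_simps)
     (rule app_op_expand, use assms preserves_unit in auto)

lemma tr_commute:
  assumes "finite A" "preserves A F" "preserves A G"
  shows "tr A (F * G) = tr A (G * F)"
  using assms by (simp add: tr_mult) (subst sum.swap, simp add: mult.commute)

text \<open>The scaled form fits operators such as \<open>1 + L\<close> or a geometric sum, which
  become idempotent only after division by \<open>N\<close>.\<close>

lemma tr_scaled_idempotent:
  fixes F :: "('a, 'c::field_char_0) linop"
  assumes A: "finite A" "preserves A F" and N: "N > 0" "F * F = of_nat N * F"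
  shows "\<exists>n::nat. tr A F = of_nat (N * n) \<and> (n = 0 \<longrightarrow> (\<forall>i\<in>A. \<forall>j\<in>A. app_op F (unit_vec j) i = 0))"
proof -
  define f where "f i j = app_op F (unit_vec j) i / of_nat N" for i j
  have "(\<Sum>k\<in>A. f i k * f k j) = f i j" if "i \<in> A" "j \<in> A" for i j
  proof -
    have "app_op (F * F) (unit_vec j) i = (\<Sum>k\<in>A. app_op F (unit_vec j) k * app_op F (unit_vec k) i)"
      using app_op_expand[of A "app_op F (unit_vec j)" F i] A preserves_unit[OF A(2)] that
      by (simp add: app_op_simps)
    moreover have "app_op (F * F) (unit_vec j) i = of_nat N * app_op F (unit_vec j) i"
      unfolding N(2) by (simp add: of_nat_eq_scal_op app_op_simps)
    ultimately have "(\<Sum>k\<in>A. app_op F (unit_vec k) i * app_op F (unit_vec j) k)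
        = of_nat N * app_op F (unit_vec j) i"
      by (simp add: mult.commute)
    then show ?thesis using N(1) by (simp add: f_def sum_divide_distrib [symmetric] field_simps)
  qed
  from idempotent_kernel_trace[OF A(1) this] obtain n :: nat where
    n: "(\<Sum>i\<in>A. f i i) = of_nat n" "n = 0 \<longrightarrow> (\<forall>i\<in>A. \<forall>j\<in>A. f i j = 0)" by auto
  have "tr A F = of_nat N * (\<Sum>i\<in>A. f i i)"
    using N(1) by (simp add: tr_def f_def sum_distrib_left)
  then show ?thesis using n N(1) by (intro exI[of _ n]) (auto simp: f_def)
qed

section \<open>Vanishing of integer traces by divisibility by all powers of 2\<close>

lemma two_linop_cancel:
  fixes F G :: "('a, int) linop"
  assumes "2 * F = 2 * G"
  shows "F = G"
proof (rule linop_eqI)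
  fix x i
  have "F + F = G + G" using assms by (simp add: mult_2)
  then have "app_op (F + F) x i = app_op (G + G) x i" by simp
  then show "app_op F x i = app_op G x i" by (simp add: app_op_simps)
qed

lemma square_one_plus_twice_central:
  fixes Y c :: "'r::ring_1"
  assumes "Y * c = c * Y"
  shows "(1 + 2 * c * Y) * (1 + 2 * c * Y) = 1 + 2 * (2 * c) * (Y + c * (Y * Y))"
proof -
  define a where "a = c * Y"
  have "a * a = c * (Y * c) * Y" by (simp add: a_def mult.assoc)
  then have aa: "c * (c * (Y * Y)) = a * a" by (simp add: assms mult.assoc)
  have "(1 + (a + a)) * (1 + (a + a)) = 1 + (a + a + a + a) + (a * a + a * a + a * a + a * a)"
    by (simp add: distrib_left distrib_right add.assoc)
  then show ?thesis
    by (simp add: mult_2 distrib_left distrib_right mult.assoc aa a_def [symmetric] add.assoc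
        add.left_commute)
qed

text \<open>Each squaring turns 1 + 2 c Y into 1 + 4 c (Y + c Y Y) and so gains a factor 2; here c
  is the central element 2^m.\<close>

lemma power_two_power_congruence:
  fixes U :: "('a, 'c::comm_ring_1) linop"
  assumes "preserves A U"
  shows "\<exists>Y. preserves A Y \<and> (1 + 2 * U) ^ (2 ^ m) = 1 + of_nat (2 ^ Suc m) * Y"
proof (induction m)
  case 0
  have "(1 + 2 * U) ^ (2 ^ 0) = 1 + of_nat (2 ^ Suc 0) * U"
    by (simp only: power_0 power_one_right power_Suc mult_1_right of_nat_numeral)
  then show ?case using assms by blast
next
  case (Suc m)
  then obtain Y where Y: "preserves A Y" "(1 + 2 * U) ^ (2 ^ m) = 1 + of_nat (2 ^ Suc m) * Y"
    by blast
  define c :: "('a, 'c) linop" where "c = of_nat (2 ^ m)"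
  have c: "Y * c = c * Y" unfolding c_def by (rule mult_of_nat_commute [symmetric])
  have "(1 + 2 * U) ^ (2 ^ Suc m) = (1 + 2 * c * Y) * (1 + 2 * c * Y)"
  proof -
    have "(1 + 2 * U) ^ (2 ^ Suc m) = (1 + 2 * U) ^ (2 ^ m) * (1 + 2 * U) ^ (2 ^ m)"
      by (simp only: power_Suc mult_2 power_add)
    moreover have "of_nat (2 ^ Suc m) = 2 * c"
      by (simp only: c_def power_Suc of_nat_mult of_nat_numeral)
    ultimately show ?thesis by (simp only: Y(2))
  qed
  also have "\<dots> = 1 + of_nat (2 ^ Suc (Suc m)) * (Y + c * (Y * Y))"
    unfolding square_one_plus_twice_central[OF c]
    by (simp only: c_def power_Suc of_nat_mult of_nat_numeral)
  finally have "(1 + 2 * U) ^ (2 ^ Suc m) = 1 + of_nat (2 ^ Suc (Suc m)) * (Y + c * (Y * Y))" .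
  moreover have "preserves A (Y + c * (Y * Y))"
    unfolding c_def by (intro preserves_simps preserves_of_nat Y(1))
  ultimately show ?case by blast
qed

text \<open>Every power \<open>Q ^ 2 ^ m\<close> commutes with \<open>T\<close> up to a sign that makes \<open>tr (Q ^ 2 ^ m * T)\<close>
  vanish, while \<open>Q ^ 2 ^ m\<close> tends 2-adically to the identity.\<close>

lemma tr_eq_0_if_anticommutes:
  fixes T U :: "('a, int) linop"
  assumes "finite A" "preserves A T" "preserves A U"
    and anti: "(1 + 2 * U) * T * proj A = - (T * (1 + 2 * U) * proj A)"
  shows "tr A T = 0"
proof -
  define Q where "Q = 1 + 2 * U"
  have Q: "preserves A Q" using assms(3) by (simp add: Q_def)
  have "2 ^ m dvd tr A T" for m
  proof -
    obtain Y where Y: "preserves A Y" "Q ^ (2 ^ m) = 1 + of_nat (2 ^ Suc m) * Y"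
      using power_two_power_congruence[OF assms(3)] by (auto simp: Q_def)
    define n :: nat where "n = 2 ^ m - 1"
    have n: "2 ^ m = Suc n" by (simp add: n_def)
    have "tr A (Q ^ (2 ^ m) * T) = tr A (Q * (Q ^ n * T))"
      unfolding n by (simp add: mult.assoc)
    also have "\<dots> = tr A (Q ^ n * T * Q)"
      by (rule tr_commute) (use assms Q in auto)
    also have "\<dots> = tr A (Q ^ n * (T * Q * proj A))"
      by (subst tr_mult_proj [symmetric]) (simp only: mult.assoc)
    also have "\<dots> = - tr A (Q ^ n * (Q * T) * proj A)"
      using anti by (simp add: Q_def mult.assoc tr_uminus)
    also have "\<dots> = tr A (- (Q ^ n * (Q * T)))"
      unfolding tr_mult_proj tr_uminus ..
    also have "\<dots> = - tr A (Q ^ (2 ^ m) * T)"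
      unfolding n by (simp add: tr_uminus power_Suc2 mult.assoc del: power_Suc)
    finally have "tr A (Q ^ (2 ^ m) * T) = 0" by simp
    moreover have "Q ^ (2 ^ m) * T = T + scal_op (2 ^ Suc m) * (Y * T)"
      unfolding Y(2) of_nat_eq_scal_op by (simp add: algebra_simps)
    ultimately have "tr A T = 2 ^ m * (- 2 * tr A (Y * T))"
      by (simp add: tr_add tr_scal)
    then show ?thesis by (rule dvdI)
  qed
  \<comment> \<open>The exponent |t| is chosen for t = tr T because 2^|t| exceeds |t|, so only t = 0
    is divisible by it.\<close>
  then have dvd: "2 ^ nat \<bar>tr A T\<bar> dvd tr A T" .
  show ?thesis
  proof (rule ccontr)
    assume "tr A T \<noteq> 0"
    with dvd have "2 ^ nat \<bar>tr A T\<bar> \<le> \<bar>tr A T\<bar>"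
      using dvd_imp_le_int[of "tr A T" "2 ^ nat \<bar>tr A T\<bar>"] by simp
    moreover have "int (nat \<bar>tr A T\<bar>) < 2 ^ nat \<bar>tr A T\<bar>" by (rule of_nat_less_two_power)
    ultimately show False by simp
  qed
qed

text \<open>If \<open>Q\<close> anticommutes with \<open>K * K\<close> (after multiplication by \<open>e\<close>), then conjugation by \<open>K\<close> maps
  \<open>Q \<mapsto> B \<mapsto> - Q\<close>. The factor \<open>e\<close> will be the projection to the functions supported on the group,
  since the operators of the group are the identity on all other functions.\<close>

lemma anticommuting_average:
  fixes K Q Ki :: "'r::ring_1"
  assumes "K * Ki = 1" "Ki * K = 1" and QKK: "Q * (K * K) * e = - (K * (K * Q) * e)"
    and e: "e * Q = Q * e" "e * Ki = Ki * e"
  defines "B \<equiv> K * Q * Ki"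
  shows "(Q * B + B * Q) * K * e = - (K * (Q * B + B * Q) * e)"
proof -
  have BK: "B * K = K * Q" by (simp add: B_def assms(2) mult.assoc)
  have KB: "K * B * e = - (Q * K * e)"
  proof -
    have KKQ: "K * (K * Q) * e = - (Q * (K * K) * e)" unfolding QKK by simp
    have "K * B * e = (K * (K * Q) * e) * Ki" using e by (simp add: B_def mult.assoc)
    also have "\<dots> = - (Q * (K * K) * (e * Ki))" unfolding KKQ by (simp add: mult.assoc)
    also have "\<dots> = - (Q * K * (K * Ki) * e)" unfolding e by (simp only: mult.assoc)
    finally show ?thesis by (simp add: assms(1))
  qed
  have QK: "Q * K * e = - (K * B * e)" unfolding KB by simp
  have "Q * B * K * e = Q * (B * K) * e" by (simp only: mult.assoc)
  also have "\<dots> = Q * K * (Q * e)" unfolding BK by (simp only: mult.assoc)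
  also have "\<dots> = Q * K * e * Q" unfolding e(1) [symmetric] by (simp only: mult.assoc)
  also have "\<dots> = - (K * B * (e * Q))" unfolding QK by (simp add: mult.assoc)
  also have "\<dots> = - (K * B * Q * e)" unfolding e(1) by (simp only: mult.assoc)
  finally have 1: "Q * B * K * e = - (K * B * Q * e)" .
  have "B * Q * K * e = B * (Q * K * e)" by (simp only: mult.assoc)
  also have "\<dots> = - (B * K * B * e)" unfolding QK by (simp add: mult.assoc)
  finally have "B * Q * K * e = - (K * Q * B * e)" unfolding BK .
  with 1 show ?thesis by (simp add: distrib_left distrib_right mult.assoc)
qed

text \<open>Descent on \<open>s\<close>: let K be \<open>T ^ (2 ^ s)\<close> and let Q anticommute
  with K K. With B the conjugate of Q by K, QB + BQ anticommutes with K by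
  \<open>anticommuting_average\<close>. Both Q and B are 1 mod 2, so QB + BQ is 2 mod 4 and half of
  it again has the form \<open>1 + 2 * U'\<close>. The exponent \<open>N\<close> makes the inverse
  of K a power of K.\<close>

lemma tr_eq_0_if_power_anticommutes:
  fixes T U :: "('a, int) linop"
  assumes "finite A" "preserves A T" "preserves A U" "T ^ N = 1" "N > 0"
    and "proj A * T = T * proj A" "proj A * U = U * proj A"
    and "(1 + 2 * U) * T ^ (2 ^ s) * proj A = - (T ^ (2 ^ s) * (1 + 2 * U) * proj A)"
  shows "tr A T = 0"
  using assms(3,7,8)
proof (induction s arbitrary: U)
  case 0
  then show ?case using tr_eq_0_if_anticommutes[OF assms(1,2)] by simp
next
  case (Suc s)
  define K Ki where "K = T ^ (2 ^ s)" and "Ki = K ^ (N - 1)"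
  have inv: "K * Ki = 1" "Ki * K = 1"
  proof -
    have "K ^ N = 1" unfolding K_def by (metis assms(4) mult.commute power_mult power_one)
    then show "K * Ki = 1" "Ki * K = 1"
      using assms(5) unfolding Ki_def by (metis power_minus_mult power_eq_if not_gr_zero)+
  qed
  have pres: "preserves A K" "preserves A Ki" using assms(2) by (auto simp: K_def Ki_def)
  define Q Y B where "Q = 1 + 2 * U" and "Y = K * U * Ki" and "B = K * Q * Ki"
  have KK: "T ^ (2 ^ Suc s) = K * K"
    by (simp add: K_def power_add [symmetric] mult_2)
  define e :: "('a, int) linop" where "e = proj A"
  have eT: "e * T ^ n = T ^ n * e" for n
    using assms(6) unfolding e_def by (rule power_commuting_commutes [symmetric, OF sym])
  have eK: "e * K = K * e" "e * Ki = Ki * e"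
    unfolding Ki_def K_def power_mult [symmetric] by (rule eT)+
  have eU: "e * U = U * e" using Suc.prems(2) by (simp add: e_def)
  have eQ: "e * Q = Q * e" by (simp add: Q_def mult_2 distrib_left distrib_right eU)
  have QKK: "Q * (K * K) * e = - (K * (K * Q) * e)"
    using Suc.prems(3) unfolding KK Q_def [symmetric] e_def by (simp add: mult.assoc)
  define U' where "U' = U + Y + U * Y + Y * U"
  have B: "B = 1 + 2 * Y"
    by (simp only: B_def Q_def Y_def mult_2 distrib_left distrib_right mult_1_left mult_1_right inv)
  have sum: "Q * B + B * Q = 2 * (1 + 2 * U')"
    unfolding B Q_def U'_def mult_2 distrib_left distrib_right mult_1_left mult_1_right
    by (simp only: add_ac one_add_one [symmetric])
  have "2 * ((1 + 2 * U') * K * e) = 2 * (- (K * (1 + 2 * U') * e))"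
  proof -
    have "2 * ((1 + 2 * U') * K * e) = (Q * B + B * Q) * K * e" unfolding sum by (simp only: mult.assoc)
    also have "\<dots> = - (K * (Q * B + B * Q) * e)"
      unfolding B_def by (rule anticommuting_average[OF inv QKK eQ eK(2)])
    also have "\<dots> = 2 * (- (K * (1 + 2 * U') * e))"
      unfolding sum mult_2 by (simp only: distrib_left distrib_right minus_add_distrib)
    finally show ?thesis .
  qed
  then have "(1 + 2 * U') * T ^ (2 ^ s) * proj A = - (T ^ (2 ^ s) * (1 + 2 * U') * proj A)"
    unfolding K_def e_def by (rule two_linop_cancel)
  moreover have "preserves A U'" using Suc.prems(1) pres by (auto simp: U'_def Y_def)
  moreover have em: "e * (F * F') = F * F' * e" if "e * F = F * e" "e * F' = F' * e" for F F'
    by (metis that mult.assoc)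
  have eY: "e * Y = Y * e" unfolding Y_def by (intro em eK eU)
  have "e * (U * Y) = U * Y * e" "e * (Y * U) = Y * U * e" by (intro em eU eY)+
  then have "proj A * U' = U' * proj A"
    unfolding e_def [symmetric] by (simp only: U'_def distrib_left distrib_right eU eY)
  ultimately show ?case using Suc.IH by blast
qed

section \<open>The group ring and the group acting on functions\<close>

text \<open>Both operators are extended by the identity outside the carrier, so that the unit elements act
  as \<open>1\<close>.\<close>

lift_definition left_op :: "('a, 'b) monoid_scheme \<Rightarrow> ('a \<Rightarrow> int) \<Rightarrow> ('a, 'c::comm_ring_1) linop"
  is "\<lambda>G u x g. if g \<in> carrier G
        then \<Sum>y\<in>carrier G. of_int (u y) * x (inv\<^bsub>G\<^esub> y \<otimes>\<^bsub>G\<^esub> g) else x g"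
  by (auto simp: fun_eq_iff algebra_simps sum.distrib sum_distrib_left)

lift_definition right_op :: "('a, 'b) monoid_scheme \<Rightarrow> 'a \<Rightarrow> ('a, 'c::comm_ring_1) linop"
  is "\<lambda>G h x g. if g \<in> carrier G then x (g \<otimes>\<^bsub>G\<^esub> h) else x g"
  by (auto simp: fun_eq_iff)

text \<open>This is the order of the centraliser of \<open>h\<close> times the sum of the
  coefficients of \<open>u\<close> over the conjugacy class of \<open>h\<close>; with this
  multiplicity it is a trace.\<close>

definition conj_sum :: "('a, 'b) monoid_scheme \<Rightarrow> ('a \<Rightarrow> int) \<Rightarrow> 'a \<Rightarrow> int" where
  "conj_sum G u h = (\<Sum>g\<in>carrier G. u (g \<otimes>\<^bsub>G\<^esub> h \<otimes>\<^bsub>G\<^esub> inv\<^bsub>G\<^esub> g))"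

lemmas group_op_simps = app_op_simps left_op.rep_eq right_op.rep_eq

lemma preserves_group_op [intro, simp]:
  "preserves (carrier G) (left_op G u)" "preserves (carrier G) (right_op G h)"
  by (simp_all add: preserves_def group_op_simps)

lemma proj_commute_group_op:
  assumes "group G"
  shows "proj (carrier G) * left_op G u = left_op G u * proj (carrier G)"
    and "h \<in> carrier G \<Longrightarrow> proj (carrier G) * right_op G h = right_op G h * proj (carrier G)"
proof -
  interpret group G by fact
  show "proj (carrier G) * left_op G u = left_op G u * proj (carrier G)"
    by (rule linop_eqI) (auto simp: group_op_simps proj_def intro!: sum.cong)
  show "h \<in> carrier G \<Longrightarrow> proj (carrier G) * right_op G h = right_op G h * proj (carrier G)"
    by (rule linop_eqI) (auto simp: group_op_simps proj_def)
qed

context group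
begin

lemma sum_left_translate:
  assumes "y \<in> carrier G"
  shows "(\<Sum>z\<in>carrier G. f z) = (\<Sum>w\<in>carrier G. f (inv y \<otimes> w))"
  using assms
  by (intro sum.reindex_bij_witness[of _ "\<lambda>w. inv y \<otimes> w" "\<lambda>z. y \<otimes> z"])
     (auto simp: m_assoc [symmetric])

lemma left_op_mult:
  "(left_op G u :: ('a, 'c::comm_ring_1) linop) * left_op G v = left_op G (group_ring_mult G u v)"
proof (rule linop_eqI)
  fix x :: "'a \<Rightarrow> 'c" and g
  show "app_op (left_op G u * left_op G v) x g = app_op (left_op G (group_ring_mult G u v)) x g"
  proof (cases "g \<in> carrier G")
    case True
    have translate: "(\<Sum>z\<in>carrier G. of_int (v z) * x (inv z \<otimes> (inv y \<otimes> g)))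
        = (\<Sum>w\<in>carrier G. of_int (v (inv y \<otimes> w)) * x (inv w \<otimes> g))" if y: "y \<in> carrier G" for y
    proof (subst sum_left_translate[OF y], rule sum.cong)
      fix w assume w: "w \<in> carrier G"
      have "y \<otimes> (inv y \<otimes> g) = g" using y True by (simp add: m_assoc [symmetric])
      then have "inv (inv y \<otimes> w) \<otimes> (inv y \<otimes> g) = inv w \<otimes> g"
        using y w True by (simp add: inv_mult_group m_assoc)
      then show "of_int (v (inv y \<otimes> w)) * x (inv (inv y \<otimes> w) \<otimes> (inv y \<otimes> g))
          = of_int (v (inv y \<otimes> w)) * x (inv w \<otimes> g)"
        by simp
    qed simp
    have "app_op (left_op G u * left_op G v) x g
        = (\<Sum>y\<in>carrier G. of_int (u y) * (\<Sum>z\<in>carrier G. of_int (v z) * x (inv z \<otimes> (inv y \<otimes> g))))"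
      using True by (auto simp: group_op_simps intro!: sum.cong)
    also have "\<dots> = (\<Sum>y\<in>carrier G. of_int (u y) *
        (\<Sum>w\<in>carrier G. of_int (v (inv y \<otimes> w)) * x (inv w \<otimes> g)))"
      by (rule sum.cong) (simp_all add: translate)
    also have "\<dots> = (\<Sum>w\<in>carrier G. \<Sum>y\<in>carrier G. of_int (u y * v (inv y \<otimes> w)) * x (inv w \<otimes> g))"
      by (subst sum.swap) (simp add: sum_distrib_left mult.assoc)
    also have "\<dots> = app_op (left_op G (group_ring_mult G u v)) x g"
      using True by (simp add: group_op_simps group_ring_mult_def sum_distrib_right)
    finally show ?thesis .
  qed (simp add: group_op_simps)
qed

lemma left_op_one: "finite (carrier G) \<Longrightarrow> left_op G (group_ring_one G) = 1"
  by (rule linop_eqI)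
     (auto simp: group_op_simps group_ring_one_def if_distrib[of of_int] if_distrib[of "\<lambda>t. t * _"]
       cong: if_cong)

text \<open>On formal sums \<open>right_op G h\<close> multiplies from the right by the inverse of
  \<open>h\<close>, which is why the order of the factors is kept.\<close>

lemma right_op_mult:
  "h \<in> carrier G \<Longrightarrow> k \<in> carrier G \<Longrightarrow> right_op G h * right_op G k = right_op G (h \<otimes> k)"
  by (rule linop_eqI) (auto simp: group_op_simps m_assoc)

lemma right_op_one: "right_op G \<one> = 1"
  by (rule linop_eqI) (auto simp: group_op_simps)

lemma right_op_pow: "h \<in> carrier G \<Longrightarrow> right_op G h ^ n = right_op G (h [^] n)"
  by (induction n) (auto simp: right_op_one right_op_mult power_Suc2 simp del: power_Suc)

lemma left_right_op_commute:
  "h \<in> carrier G \<Longrightarrow> left_op G u * right_op G h = right_op G h * left_op G u"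
  by (rule linop_eqI) (auto simp: group_op_simps m_assoc intro!: sum.cong)

lemma left_right_op_power:
  assumes "h \<in> carrier G"
  shows "(left_op G u * right_op G h :: ('a, 'c::comm_ring_1) linop) ^ n = left_op G u ^ n * right_op G (h [^] n)"
proof (induction n)
  case 0
  then show ?case by (simp add: right_op_one)
next
  case (Suc n)
  have "(left_op G u * right_op G h :: ('a, 'c) linop) ^ Suc n
      = left_op G u ^ n * (right_op G (h [^] n) * left_op G u) * right_op G h"
    unfolding power_Suc2 Suc.IH by (simp only: mult.assoc)
  also have "\<dots> = left_op G u ^ n * (left_op G u * right_op G (h [^] n)) * right_op G h"
    by (simp only: left_right_op_commute nat_pow_closed assms)
  also have "\<dots> = left_op G u ^ Suc n * (right_op G (h [^] n) * right_op G h)"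
    by (simp only: power_Suc2 mult.assoc)
  also have "\<dots> = left_op G u ^ Suc n * right_op G (h [^] Suc n)"
    using assms by (simp add: right_op_mult del: power_Suc)
  finally show ?case .
qed

text \<open>The diagonal entry at g picks the coefficient of the only y with inv y g h = g, namely y
  = g h inv g.\<close>

lemma tr_left_right_op:
  assumes "finite (carrier G)" "h \<in> carrier G"
  shows "tr (carrier G) (left_op G u * right_op G h :: ('a, 'c::comm_ring_1) linop) = of_int (conj_sum G u h)"
proof -
  have "(\<Sum>y\<in>carrier G. of_int (u y) * (unit_vec g (inv y \<otimes> g \<otimes> h) :: 'c))
      = of_int (u (g \<otimes> h \<otimes> inv g))" if g: "g \<in> carrier G" for g
  proof -
    have *: "inv y \<otimes> g \<otimes> h = g \<longleftrightarrow> y = g \<otimes> h \<otimes> inv g" if "y \<in> carrier G" for y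
    proof -
      have "inv y \<otimes> g \<otimes> h = g \<longleftrightarrow> g \<otimes> h = y \<otimes> g"
        using that g assms(2) by (metis inv_solve_left m_assoc m_closed inv_closed)
      also have "\<dots> \<longleftrightarrow> y = g \<otimes> h \<otimes> inv g"
        using that g assms(2) by (metis inv_solve_right m_closed)
      finally show ?thesis .
    qed
    have "(\<Sum>y\<in>carrier G. of_int (u y) * (unit_vec g (inv y \<otimes> g \<otimes> h) :: 'c))
        = (\<Sum>y\<in>carrier G. if y = g \<otimes> h \<otimes> inv g then of_int (u y) else 0)"
      by (rule sum.cong) (auto simp: unit_vec_def *)
    then show ?thesis using g assms by simp
  qed
  then show ?thesis
    using assms by (simp add: tr_def group_op_simps conj_sum_def)
qed

lemma conj_sum_one: "conj_sum G u \<one> = int (order G) * u \<one>"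
  by (simp add: conj_sum_def order_def)

lemma conj_sum_conj:
  assumes "h \<in> carrier G" "k \<in> carrier G"
  shows "conj_sum G u (k \<otimes> h \<otimes> inv k) = conj_sum G u h"
  unfolding conj_sum_def using assms
  by (intro sum.reindex_bij_witness[of _ "\<lambda>g. g \<otimes> inv k" "\<lambda>g. g \<otimes> k"])
     (auto simp: m_assoc inv_mult_group)

section \<open>Vanishing of class sums\<close>

lemma pow_eq_parity:
  assumes "y \<in> carrier G" "even (ord y)" "y [^] (m::nat) = y [^] (n::nat)"
  shows "even m \<longleftrightarrow> even n"
proof -
  have *: "even m \<longleftrightarrow> even n" if "m \<le> n" "y [^] m = y [^] n" for m n :: nat
  proof -
    have "y [^] m \<otimes> y [^] (n - m) = y [^] (m + (n - m))"
      using assms(1) by (rule nat_pow_mult)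
    also have "\<dots> = y [^] m \<otimes> \<one>" using that assms(1) by simp
    finally have "y [^] m \<otimes> y [^] (n - m) = y [^] m \<otimes> \<one>" .
    then have "y [^] (n - m) = \<one>"
      using assms(1) by (simp add: l_cancel del: r_one)
    then have "even (n - m)" using assms(1,2) pow_eq_id dvd_trans by blast
    then show ?thesis using that(1) by presburger
  qed
  show ?thesis
  proof (cases "m \<le> n")
    case True
    then show ?thesis using assms(3) by (rule *)
  next
    case False
    then have "n \<le> m" by simp
    from *[OF this assms(3) [symmetric]] show ?thesis by (rule sym)
  qed
qed

text \<open>The function 1 + 2 e is a sign that flips under right translation by \<open>y\<close>.
  On each left coset of the powers of \<open>y\<close> it records the parity of the exponent counted
  from a chosen base point \<open>r g\<close>, which is well defined by \<open>pow_eq_parity\<close>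
  because \<open>y\<close> has even order.\<close>

lemma alternating_function:
  assumes "finite (carrier G)" and y: "y \<in> carrier G" "even (ord y)"
  shows "\<exists>e :: 'a \<Rightarrow> int. \<forall>g\<in>carrier G. e (g \<otimes> y) = - 1 - e g"
proof -
  define S where "S g = {g \<otimes> y [^] m | m :: nat. True}" for g
  define r where "r g = (SOME k. k \<in> S g)" for g
  define e :: "'a \<Rightarrow> int" where "e g = (if \<exists>m::nat. even m \<and> g = r g \<otimes> y [^] m then 0 else - 1)" for g
  \<comment> \<open>Exponents are natural numbers here, so y^(ord y - 1) plays the inverse of
    y.\<close>
  have shift: "y \<otimes> y [^] (m + (ord y - 1)) = y [^] m" for m
  proof -
    have "ord y > 0" using ord_ge_1[OF assms(1) y(1)] by simp
    then have "y \<otimes> y [^] (m + (ord y - 1)) = y [^] (m + ord y)"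
      using y(1) by (metis Suc_pred' add_Suc_right nat_pow_Suc2)
    then show ?thesis using y(1) by (simp add: nat_pow_mult [symmetric] pow_ord_eq_1)
  qed
  have S: "S (g \<otimes> y) = S g" if g: "g \<in> carrier G" for g
  proof
    show "S (g \<otimes> y) \<subseteq> S g"
    proof
      fix k assume "k \<in> S (g \<otimes> y)"
      then obtain m :: nat where "k = g \<otimes> y \<otimes> y [^] m" by (auto simp: S_def)
      then have "k = g \<otimes> y [^] Suc m" using g y(1) by (simp only: m_assoc nat_pow_Suc2 nat_pow_closed)
      then show "k \<in> S g" unfolding S_def by blast
    qed
    show "S g \<subseteq> S (g \<otimes> y)"
    proof
      fix k assume "k \<in> S g"
      then obtain m :: nat where "k = g \<otimes> y [^] m" by (auto simp: S_def)
      then have "k = g \<otimes> y \<otimes> y [^] (m + (ord y - 1))" using g y(1) shift[of m] by (simp add: m_assoc)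
      then show "k \<in> S (g \<otimes> y)" unfolding S_def by blast
    qed
  qed
  have r: "\<exists>m::nat. g = r g \<otimes> y [^] m" "r g \<in> carrier G" if g: "g \<in> carrier G" for g
  proof -
    have "g \<in> S g" using g unfolding S_def by (auto intro!: exI[of _ "0::nat"])
    then have "r g \<in> S g" unfolding r_def by (rule someI)
    then obtain m :: nat where m: "r g = g \<otimes> y [^] m" unfolding S_def by blast
    then show "r g \<in> carrier G" using g y(1) by simp
    have "r g \<otimes> y [^] (m * (ord y - 1)) = g \<otimes> y [^] (m * ord y)"
    proof -
      have "m + m * (ord y - 1) = m * ord y"
        using ord_ge_1[OF assms(1) y(1)] by (cases "ord y") auto
      then show ?thesis using m g y(1) by (simp add: m_assoc nat_pow_mult)
    qed
    also have "\<dots> = g" using g y(1)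
      by (metis mult.commute nat_pow_one nat_pow_pow pow_ord_eq_1 r_one)
    finally show "\<exists>m::nat. g = r g \<otimes> y [^] m" by metis
  qed
  have e: "e g = (if even m then 0 else - 1)" if g: "g \<in> carrier G" and m: "g = r g \<otimes> y [^] (m::nat)" for g m
  proof -
    have "even n \<longleftrightarrow> even m" if n: "g = r g \<otimes> y [^] (n::nat)" for n
    proof (rule pow_eq_parity[OF y])
      have "r g \<otimes> y [^] n = r g \<otimes> y [^] m" using n m by simp
      then show "y [^] n = y [^] m" using r(2)[OF g] y(1) by simp
    qed
    then have "(\<exists>n::nat. even n \<and> g = r g \<otimes> y [^] n) \<longleftrightarrow> even m" using m by blast
    then show ?thesis unfolding e_def by (simp only:)
  qed
  have "e (g \<otimes> y) = - 1 - e g" if g: "g \<in> carrier G" for g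
  proof -
    obtain m :: nat where m: "g = r g \<otimes> y [^] m" using r[OF g] by blast
    have rr: "r (g \<otimes> y) = r g" by (simp add: r_def S[OF g])
    have gy: "g \<otimes> y = r (g \<otimes> y) \<otimes> y [^] Suc m"
      unfolding rr
    proof -
      have "r g \<otimes> y [^] Suc m = (r g \<otimes> y [^] m) \<otimes> y"
        using r(2)[OF g] y(1) by (simp add: m_assoc)
      then show "g \<otimes> y = r g \<otimes> y [^] Suc m" unfolding m [symmetric] by (rule sym)
    qed
    show ?thesis using e[OF m_closed[OF g y(1)] gy] e[OF g m] by simp
  qed
  then show ?thesis by blast
qed

text \<open>The operator \<open>T\<close> given by \<open>u\<close> and \<open>h\<close> has a power \<open>T ^ 2 ^ s\<close> that is the right translation by an
  element of even order; a function changing sign along its orbits anticommutes with it.\<close>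

lemma conj_sum_eq_0:
  assumes fin: "finite (carrier G)" and u: "(left_op G u :: ('a, int) linop) ^ (2 ^ s) = 1"
    and h: "h \<in> carrier G" "2 ^ Suc s dvd ord h"
  shows "conj_sum G u h = 0"
proof -
  define T :: "('a, int) linop" where "T = left_op G u * right_op G h"
  define y where "y = h [^] ((2::nat) ^ s)"
  have y: "y \<in> carrier G" using h(1) by (simp add: y_def)
  have "h [^] (2 ^ s * ord y) = \<one>"
    using h(1) pow_ord_eq_1[OF y] by (simp add: y_def nat_pow_pow [symmetric])
  then have "2 ^ Suc s dvd 2 ^ s * ord y" using h pow_eq_id dvd_trans by blast
  then have "even (ord y)" by simp
  from alternating_function[OF fin y this] obtain e :: "'a \<Rightarrow> int" where
    e: "\<And>g. g \<in> carrier G \<Longrightarrow> e (g \<otimes> y) = - 1 - e g" by blast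
  have Ty: "T ^ (2 ^ s) = right_op G y"
    unfolding T_def left_right_op_power[OF h(1)] u y_def by simp
  have "tr (carrier G) T = 0"
  proof (rule tr_eq_0_if_power_anticommutes[OF fin, where U = "diag_op e" and s = s
        and N = "2 ^ s * order G"])
    show "preserves (carrier G) T" by (simp add: T_def)
    have "right_op G y ^ order G = (1 :: ('a, int) linop)"
      using y by (simp add: right_op_pow pow_order_eq_1 right_op_one)
    then show "T ^ (2 ^ s * order G) = 1" by (simp only: power_mult Ty)
    show "0 < 2 ^ s * order G" using fin by (simp add: order_gt_0_iff_finite)
    have "proj (carrier G) * T = (proj (carrier G) * left_op G u) * right_op G h"
      by (simp only: T_def mult.assoc)
    also have "\<dots> = left_op G u * (proj (carrier G) * right_op G h)"
      unfolding proj_commute_group_op(1)[OF is_group] by (simp only: mult.assoc)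
    also have "\<dots> = T * proj (carrier G)"
      unfolding proj_commute_group_op(2)[OF is_group h(1)] by (simp only: T_def mult.assoc)
    finally show "proj (carrier G) * T = T * proj (carrier G)" .
    show "proj (carrier G) * diag_op e = diag_op e * proj (carrier G)"
      by (rule linop_eqI) (simp add: proj_def app_op_simps)
    show "(1 + 2 * diag_op e) * T ^ (2 ^ s) * proj (carrier G)
        = - (T ^ (2 ^ s) * (1 + 2 * diag_op e) * proj (carrier G))"
      unfolding Ty mult_2
      by (rule linop_eqI) (auto simp: group_op_simps proj_def e y algebra_simps)
  qed simp_all
  then show ?thesis using tr_left_right_op[OF fin h(1), where 'c = int] by (simp add: T_def)
qed

section \<open>Coefficients of involutions, and elements of order 4\<close>

text \<open>On the carrier, the image of the unit vector at the identity is \<open>u\<close> itself,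
  so an operator identity on unit vectors determines \<open>u\<close>.\<close>

lemma app_left_op_unit:
  assumes "finite (carrier G)" "i \<in> carrier G"
  shows "app_op (left_op G u) (unit_vec \<one>) i = (of_int (u i) :: 'c::comm_ring_1)"
proof -
  have "inv y \<otimes> i = \<one> \<longleftrightarrow> y = i" if "y \<in> carrier G" for y
    using that assms(2) by (metis inv_closed inv_equality inv_inv l_inv)
  then have "(\<Sum>y\<in>carrier G. of_int (u y) * (unit_vec \<one> (inv y \<otimes> i) :: 'c))
      = (\<Sum>y\<in>carrier G. if y = i then of_int (u y) else 0)"
    by (intro sum.cong) (auto simp: unit_vec_def)
  then show ?thesis using assms by (simp add: left_op.rep_eq)
qed

text \<open>The special case of the Berman--Higman theorem for involutions: \<open>1 + u\<close> and \<open>1 - u\<close> are twice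
  idempotents, so their traces are nonnegative.\<close>

lemma involution_coeff_one:
  assumes fin: "finite (carrier G)" and u: "u \<in> group_ring_elems G" "augmentation G u = 1"
    "group_ring_mult G u u = group_ring_one G" "u \<noteq> group_ring_one G"
  shows "u \<one> = 0"
proof -
  define L :: "('a, real) linop" where "L = left_op G u"
  have LL: "L * L = 1" by (simp add: L_def left_op_mult u(3) left_op_one fin)
  have pres: "preserves (carrier G) L" by (simp add: L_def)
  have trL: "tr (carrier G) L = real (order G) * of_int (u \<one>)"
    using tr_left_right_op[OF fin one_closed, of u, where 'c = real]
    by (simp add: L_def right_op_one conj_sum_one)
  have tr1: "tr (carrier G) (1 :: ('a, real) linop) = real (order G)"
    by (simp add: tr_one fin order_def)
  have pos: "order G > 0" using fin by (simp add: order_gt_0_iff_finite)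
  have "(1 + L) * (1 + L) = of_nat 2 * (1 + L)"
    by (simp add: distrib_left distrib_right mult_2 LL)
  from tr_scaled_idempotent[OF fin _ _ this] pres obtain n :: nat where
    n: "real (order G) * (1 + of_int (u \<one>)) = real (2 * n)"
      "n = 0 \<longrightarrow> (\<forall>i\<in>carrier G. \<forall>j\<in>carrier G. app_op (1 + L) (unit_vec j) i = 0)"
    by (auto simp: tr_add tr1 trL distrib_left)
  have "(1 - L) * (1 - L) = of_nat 2 * (1 - L)"
    by (simp add: left_diff_distrib right_diff_distrib mult_2 LL)
  from tr_scaled_idempotent[OF fin _ _ this] pres obtain k :: nat where
    k: "real (order G) * (1 - of_int (u \<one>)) = real (2 * k)"
      "k = 0 \<longrightarrow> (\<forall>i\<in>carrier G. \<forall>j\<in>carrier G. app_op (1 - L) (unit_vec j) i = 0)"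
    by (auto simp: tr_diff tr1 trL right_diff_distrib)
  have "0 \<le> real (order G) * (1 + of_int (u \<one>))" "0 \<le> real (order G) * (1 - of_int (u \<one>))"
    unfolding n(1) k(1) by simp_all
  then have "0 \<le> 1 + real_of_int (u \<one>)" "0 \<le> 1 - real_of_int (u \<one>)"
    using pos by (simp_all add: zero_le_mult_iff)
  then have "u \<one> = 0 \<or> u \<one> = 1 \<or> u \<one> = - 1" by linarith
  \<comment> \<open>The values 1 and -1 make one of the two traces 0, so 1 - L or 1 + L vanishes on
    the carrier and u is 1 or -1. The first is excluded by hypothesis, the second by the
    augmentation.\<close>
  moreover have "u \<one> \<noteq> 1"
  proof
    assume "u \<one> = 1"
    then have "k = 0" using k(1) by simp
    have "u i = (if i = \<one> then 1 else 0)" if "i \<in> carrier G" for i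
    proof -
      have "app_op (1 - L) (unit_vec \<one>) i = 0" using k(2) \<open>k = 0\<close> that by blast
      then have "real_of_int (u i) = unit_vec \<one> i"
        using app_left_op_unit[OF fin that, of u, where 'c = real] by (simp add: L_def app_op_simps)
      then show ?thesis by (simp add: unit_vec_def split: if_splits)
    qed
    moreover have "u i = 0" if "i \<notin> carrier G" for i
      using u(1) that by (simp add: group_ring_elems_def)
    ultimately have "u = group_ring_one G"
      unfolding group_ring_one_def fun_eq_iff by (metis one_closed)
    then show False using u(4) by simp
  qed
  moreover have "u \<one> \<noteq> - 1"
  proof
    assume "u \<one> = - 1"
    then have "n = 0" using n(1) by simp
    have *: "u i = (if i = \<one> then - 1 else 0)" if "i \<in> carrier G" for i
    proof -
      have "app_op (1 + L) (unit_vec \<one>) i = 0" using n(2) \<open>n = 0\<close> that by blast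
      then have "real_of_int (u i) = - unit_vec \<one> i"
        using app_left_op_unit[OF fin that, of u, where 'c = real] by (simp add: L_def app_op_simps)
      then show ?thesis by (simp add: unit_vec_def split: if_splits)
    qed
    have "augmentation G u = - 1" unfolding augmentation_def using * fin by simp
    then show False using u(2) by simp
  qed
  ultimately show ?thesis by blast
qed

text \<open>In the sum of u y * u (inv y) the terms of y and inv y agree, so modulo 2 only y = inv y
  remains, and there the square of u y has the parity of u y.\<close>

lemma square_coeff_one_parity:
  assumes "finite (carrier G)"
  shows "even (group_ring_mult G u u \<one>) \<longleftrightarrow> even (\<Sum>y | y \<in> carrier G \<and> y \<otimes> y = \<one>. u y)"
proof -
  have inv_eq: "inv y = y \<longleftrightarrow> y \<otimes> y = \<one>" if "y \<in> carrier G" for y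
    using that by (metis inv_equality r_inv)
  have "even (\<Sum>y\<in>carrier G. u y * u (inv y))
      \<longleftrightarrow> even (\<Sum>y | y \<in> carrier G \<and> inv y = y. u y * u (inv y))"
    using assms by (intro sum_involution_parity) auto
  also have "(\<Sum>y | y \<in> carrier G \<and> inv y = y. u y * u (inv y))
      = (\<Sum>y | y \<in> carrier G \<and> y \<otimes> y = \<one>. u y * u y)"
    by (rule sum.cong) (use inv_eq in force)+
  also have "even \<dots> \<longleftrightarrow> even (\<Sum>y | y \<in> carrier G \<and> y \<otimes> y = \<one>. u y)"
  proof -
    have "even ((\<Sum>y | y \<in> carrier G \<and> y \<otimes> y = \<one>. u y * u y) - (\<Sum>y | y \<in> carrier G \<and> y \<otimes> y = \<one>. u y))"
      unfolding sum_subtractf [symmetric] by (rule dvd_sum) simp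
    then show ?thesis by simp
  qed
  finally show ?thesis by (simp add: group_ring_mult_def)
qed

text \<open>Modulo 2, the coefficient of \<open>\<one>\<close> in \<open>u * u\<close> is the sum of the coefficients of \<open>u\<close> at the square
  roots of \<open>\<one>\<close>. Without elements of order 4 this forces \<open>b \<one> \<equiv> (b * b) \<one>\<close>.\<close>

lemma exists_fourth_root_of_one:
  assumes fin: "finite (carrier G)" and a: "b = group_ring_mult G a a" "b \<in> group_ring_elems G"
    "augmentation G b = 1" "group_ring_mult G b b = group_ring_one G" "b \<noteq> group_ring_one G"
  shows "\<exists>g\<in>carrier G. (g \<otimes> g) \<otimes> (g \<otimes> g) = \<one> \<and> g \<otimes> g \<noteq> \<one>"
proof (rule ccontr)
  assume no: "\<not> ?thesis"
  define I where "I = {y \<in> carrier G. y \<otimes> y = \<one>}"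
  define S where "S = {(z, w). z \<in> carrier G \<and> w \<in> carrier G \<and> z \<otimes> w \<in> I}"
  have root: "z \<otimes> z \<otimes> (z \<otimes> z) = \<one> \<longleftrightarrow> z \<otimes> z = \<one>" if "z \<in> carrier G" for z
  proof (cases "z \<otimes> z = \<one>")
    case False
    then show ?thesis using no that by blast
  qed simp
  have "b \<one> = 0" using involution_coeff_one[OF fin a(2-5)] .
  then have "even (sum a I)" using square_coeff_one_parity[OF fin, of a] a(1) by (simp add: I_def)
  \<comment> \<open>w z is conjugate to z w by z.\<close>
  have swap: "w \<otimes> z \<in> I" if zw: "z \<in> carrier G" "w \<in> carrier G" "z \<otimes> w \<in> I" for z w
  proof -
    have "w \<otimes> z \<otimes> (w \<otimes> z) = inv z \<otimes> (z \<otimes> w \<otimes> (z \<otimes> w)) \<otimes> z"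
      using zw(1,2) by (simp add: m_assoc [symmetric])
    then show ?thesis using zw by (simp add: I_def)
  qed
  have cancel: "z \<otimes> (inv z \<otimes> y) = y" "inv z \<otimes> (z \<otimes> y) = y"
    if "z \<in> carrier G" "y \<in> carrier G" for z y
    using that by (simp_all add: m_assoc [symmetric])
  have "S \<subseteq> carrier G \<times> carrier G" by (auto simp: S_def)
  then have finS: "finite S" using fin finite_subset by blast
  have "sum b I = (\<Sum>y\<in>I. \<Sum>z\<in>carrier G. a z * a (inv z \<otimes> y))"
    by (rule sum.cong) (auto simp: a(1) group_ring_mult_def I_def)
  also have "\<dots> = (\<Sum>(y, z)\<in>I \<times> carrier G. a z * a (inv z \<otimes> y))"
    by (simp add: sum.cartesian_product)
  also have "\<dots> = (\<Sum>(z, w)\<in>S. a z * a w)"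
    by (rule sum.reindex_bij_witness[of _ "\<lambda>(z, w). (z \<otimes> w, z)" "\<lambda>(y, z). (z, inv z \<otimes> y)"])
       (auto simp: S_def I_def cancel)
  finally have "even (sum b I) \<longleftrightarrow> even (\<Sum>p\<in>S. a (fst p) * a (snd p))"
    by (simp add: case_prod_beta)
  also have "\<dots> \<longleftrightarrow> even (\<Sum>p | p \<in> S \<and> prod.swap p = p. a (fst p) * a (snd p))"
  proof (rule sum_involution_parity[OF finS])
    show "prod.swap p \<in> S" if "p \<in> S" for p
      using that swap by (auto simp: S_def)
  qed (simp_all add: mult.commute)
  also have "(\<Sum>p | p \<in> S \<and> prod.swap p = p. a (fst p) * a (snd p)) = (\<Sum>z\<in>I. a z * a z)"
  proof -
    \<comment> \<open>A pair fixed by the swap is (z, z) with z^2 in I, that is z^4 = 1; since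
      elements of order 4 are assumed away, this means z in I.\<close>
    have diag: "(z, z) \<in> S \<longleftrightarrow> z \<in> I" for z
      using root[of z] by (cases "z \<in> carrier G") (simp_all add: S_def I_def)
    have "{p. p \<in> S \<and> prod.swap p = p} = (\<lambda>z. (z, z)) ` I"
    proof (intro subset_antisym subsetI)
      fix p assume "p \<in> {p. p \<in> S \<and> prod.swap p = p}"
      then have p: "p \<in> S" "fst (prod.swap p) = fst p" by simp_all
      have "snd p = fst p" using p(2) by simp
      then obtain z where "p = (z, z)" by (metis prod.collapse)
      then show "p \<in> (\<lambda>z. (z, z)) ` I" using p(1) diag[of z] by simp
    next
      fix p assume "p \<in> (\<lambda>z. (z, z)) ` I"
      then obtain z where "p = (z, z)" "z \<in> I" by blast
      then show "p \<in> {p. p \<in> S \<and> prod.swap p = p}" using diag[of z] by simp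
    qed
    then show ?thesis by (simp add: sum.reindex inj_on_def)
  qed
  also have "even \<dots> \<longleftrightarrow> even (sum a I)"
  proof -
    have "even ((\<Sum>z\<in>I. a z * a z) - sum a I)"
      unfolding sum_subtractf [symmetric] by (rule dvd_sum) simp
    then show ?thesis by simp
  qed
  finally have "even (sum b I)" using \<open>even (sum a I)\<close> by simp
  then have "even (group_ring_mult G b b \<one>)" using square_coeff_one_parity[OF fin, of b] by (simp add: I_def)
  then show False by (simp add: a(4) group_ring_one_def)
qed

section \<open>Extending 2-subgroups inside their normalisers\<close>

lemma inv_mult_cancel:
  assumes "x \<in> carrier G" "y \<in> carrier G"
  shows "inv x \<otimes> (x \<otimes> y) = y" "x \<otimes> (inv x \<otimes> y) = y"
  using assms by (simp_all add: m_assoc [symmetric])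

lemma conj_hom: "t \<in> carrier G \<Longrightarrow> (\<lambda>y. t \<otimes> y \<otimes> inv t) \<in> hom G G"
  by (rule homI) (simp_all add: m_assoc inv_mult_cancel)

lemma conj_int_pow:
  assumes "t \<in> carrier G" "c \<in> carrier G"
  shows "t \<otimes> c [^] (j::int) \<otimes> inv t = (t \<otimes> c \<otimes> inv t) [^] j"
  using hom_int_pow[OF conj_hom[OF assms(1)] assms(2) is_group is_group] .

lemma r_coset_right_invariant_iff:
  assumes D: "subgroup D G" and t: "t \<in> carrier G" and d: "d \<in> carrier G"
  shows "(D #> t) #> d = D #> t \<longleftrightarrow> t \<otimes> d \<otimes> inv t \<in> D"
proof -
  have sub: "D \<subseteq> carrier G" using D by (rule subgroup.subset)
  have "(D #> t) #> d = D #> (t \<otimes> d)" using sub t d by (rule coset_mult_assoc)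
  moreover have "D #> (t \<otimes> d) = D #> t \<longleftrightarrow> D #> (t \<otimes> d \<otimes> inv t) = D"
    using coset_mult_inv1[of D "t \<otimes> d" t] coset_mult_inv2[of D "t \<otimes> d" t] sub t d by auto
  moreover have "D #> (t \<otimes> d \<otimes> inv t) = D \<longleftrightarrow> t \<otimes> d \<otimes> inv t \<in> D"
    using coset_join1[OF _ _ D] coset_join2[OF _ D] t d by auto
  ultimately show ?thesis by simp
qed

lemma r_coset_funpow:
  assumes "M \<subseteq> carrier G" "d \<in> carrier G"
  shows "((\<lambda>M. M #> d) ^^ n) M = M #> (d [^] n)"
  using assms by (induction n) (simp_all add: coset_mult_assoc)

lemma r_coset_eq_iff:
  assumes "subgroup D G" "x \<in> carrier G" "y \<in> carrier G"
  shows "D #> x = D #> y \<longleftrightarrow> x \<otimes> inv y \<in> D"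
proof -
  have sub: "D \<subseteq> carrier G" using assms(1) by (rule subgroup.subset)
  have "D #> x = D #> y \<longleftrightarrow> D #> (x \<otimes> inv y) = D"
    using coset_mult_inv1[OF _ assms(2,3) sub] coset_mult_inv2[OF _ assms(2,3) sub] by blast
  also have "\<dots> \<longleftrightarrow> x \<otimes> inv y \<in> D"
    using coset_join1[of D "x \<otimes> inv y"] coset_join2[of "x \<otimes> inv y" D] assms by auto
  finally show ?thesis .
qed

text \<open>The number of right cosets of \<open>D\<close> has the parity of the number of those fixed by the
  2-elements \<open>c\<close> and \<open>g\<close>, which are the cosets in the normaliser; the inversion of these fixes
  \<open>D\<close> and hence another coset.\<close>

lemma normalizer_growth:
  assumes fin: "finite (carrier G)" and D: "subgroup D G" and index: "2 * card D dvd order G"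
    and cg: "c \<in> D" "g \<in> D" "c [^] ((2::nat) ^ a) = \<one>" "g [^] ((2::nat) ^ b) = \<one>"
    and norm: "g \<otimes> c = c [^] (j::int) \<otimes> g"
    and gen: "\<And>H. subgroup H G \<Longrightarrow> c \<in> H \<Longrightarrow> g \<in> H \<Longrightarrow> D \<subseteq> H"
  shows "\<exists>h\<in>carrier G. h \<notin> D \<and> (\<forall>d\<in>D. h \<otimes> d \<otimes> inv h \<in> D) \<and> h \<otimes> h \<in> D"
proof -
  have sub: "D \<subseteq> carrier G" using D by (rule subgroup.subset)
  have carr: "c \<in> carrier G" "g \<in> carrier G" using cg sub by auto
  define R where "R = rcosets D"
  have R: "finite R" "even (card R)"
  proof -
    show "finite R" unfolding R_def using fin sub
      by (simp add: RCOSETS_def)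
    have "card D > 0" using fin sub subgroup.one_closed[OF D] finite_subset card_gt_0_iff by blast
    moreover have "card R * card D = order G" unfolding R_def using lagrange_finite[OF fin D] .
    ultimately show "even (card R)" using index by (metis dvd_times_right_cancel_iff neq0_conv)
  qed
  have in_R: "D #> t \<in> R" if "t \<in> carrier G" for t unfolding R_def by (rule rcosetsI[OF sub that])
  have R_cases: "\<exists>t\<in>carrier G. M = D #> t" if "M \<in> R" for M
    using that by (auto simp: R_def RCOSETS_def)
  have R_mult: "M #> d \<in> R" "M \<subseteq> carrier G" if M: "M \<in> R" and d: "d \<in> carrier G" for M d
  proof -
    obtain t where t: "t \<in> carrier G" "M = D #> t" using R_cases[OF M] by blast
    then show "M \<subseteq> carrier G" using sub by (simp add: r_coset_subset_G)
    show "M #> d \<in> R" using t d in_R[of "t \<otimes> d"] sub by (simp add: coset_mult_assoc)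
  qed
  define R1 where "R1 = {M \<in> R. M #> c = M}"
  define R2 where "R2 = {M \<in> R1. M #> g = M}"
  have "even (card R) \<longleftrightarrow> even (card R1)"
    unfolding R1_def
  proof (rule card_fixed_points_parity[OF R(1)])
    show "((\<lambda>M. M #> c) ^^ 2 ^ a) M = M" if "M \<in> R" for M
      using R_mult(2)[OF that carr(1)] carr cg(3) by (simp add: r_coset_funpow)
  qed (use R_mult carr in auto)
  also have "\<dots> \<longleftrightarrow> even (card R2)"
    unfolding R2_def
  proof (rule card_fixed_points_parity)
    show "finite R1" using R(1) by (simp add: R1_def)
    show "((\<lambda>M. M #> g) ^^ 2 ^ b) M = M" if "M \<in> R1" for M
      using R_mult(2)[of M, OF _ carr(1)] that carr cg(4) by (simp add: r_coset_funpow R1_def)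
    \<comment> \<open>Since g c = c^j g, a coset M fixed by c satisfies M g c = M c^j g = M
      g.\<close>
    show "M #> g \<in> R1" if M: "M \<in> R1" for M
    proof -
      obtain t where t: "t \<in> carrier G" "M = D #> t" using M R_cases unfolding R1_def by blast
      have "M #> c [^] j = M"
      proof -
        have tc: "t \<otimes> c \<otimes> inv t \<in> D"
          using M t carr r_coset_right_invariant_iff[OF D, of t c] by (simp add: R1_def)
        have "t \<otimes> c [^] j \<otimes> inv t = (t \<otimes> c \<otimes> inv t) [^] j"
          using t(1) carr(1) by (rule conj_int_pow)
        also have "\<dots> \<in> D" using tc D by (simp add: subgroup_int_pow_closed)
        finally show ?thesis using t carr r_coset_right_invariant_iff[OF D, of t "c [^] j"] by simp
      qed
      then have "M #> g #> c = M #> g"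
        using R_mult(2)[of M, OF _ carr(1)] M carr norm
        by (metis (no_types, lifting) R1_def coset_mult_assoc int_pow_closed mem_Collect_eq)
      then show ?thesis using M R_mult(1)[OF _ carr(2)] by (simp add: R1_def)
    qed
  qed
  finally have even: "even (card R2)" using R(2) by simp
  define N where "N = {t \<in> carrier G. \<forall>d\<in>D. t \<otimes> d \<otimes> inv t \<in> D}"
  have R2_iff: "D #> t \<in> R2 \<longleftrightarrow> t \<in> N" if t: "t \<in> carrier G" for t
  proof
    assume "t \<in> N"
    then show "D #> t \<in> R2"
      using in_R t carr cg r_coset_right_invariant_iff[OF D t] by (simp add: R2_def R1_def N_def)
  next
    assume "D #> t \<in> R2"
    then have "t \<otimes> c \<otimes> inv t \<in> D" "t \<otimes> g \<otimes> inv t \<in> D"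
      using t carr r_coset_right_invariant_iff[OF D t] by (simp_all add: R2_def R1_def)
    \<comment> \<open>The elements that t conjugates into D form a subgroup; it contains c and g,
      hence D by \<open>gen\<close>.\<close>
    moreover have "subgroup {y \<in> carrier G. t \<otimes> y \<otimes> inv t \<in> D} G"
    proof (rule subgroupI)
      fix x y assume "x \<in> {y \<in> carrier G. t \<otimes> y \<otimes> inv t \<in> D}" "y \<in> {y \<in> carrier G. t \<otimes> y \<otimes> inv t \<in> D}"
      then have x: "x \<in> carrier G" "t \<otimes> x \<otimes> inv t \<in> D" and y: "y \<in> carrier G" "t \<otimes> y \<otimes> inv t \<in> D" by auto
      have "t \<otimes> (x \<otimes> y) \<otimes> inv t = t \<otimes> x \<otimes> inv t \<otimes> (t \<otimes> y \<otimes> inv t)"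
        using t x(1) y(1) by (simp add: m_assoc inv_mult_cancel)
      then show "x \<otimes> y \<in> {y \<in> carrier G. t \<otimes> y \<otimes> inv t \<in> D}"
        using x y subgroup.m_closed[OF D x(2) y(2)] by simp
    next
      fix x assume "x \<in> {y \<in> carrier G. t \<otimes> y \<otimes> inv t \<in> D}"
      then have x: "x \<in> carrier G" "t \<otimes> x \<otimes> inv t \<in> D" by auto
      have "t \<otimes> inv x \<otimes> inv t = inv (t \<otimes> x \<otimes> inv t)"
        using t x(1) by (simp add: m_assoc inv_mult_group)
      then show "inv x \<in> {y \<in> carrier G. t \<otimes> y \<otimes> inv t \<in> D}"
        using x subgroup.m_inv_closed[OF D x(2)] by simp
    qed (use t subgroup.one_closed[OF D] in auto)
    ultimately show "t \<in> N" using gen[of "{y \<in> carrier G. t \<otimes> y \<otimes> inv t \<in> D}"] carr t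
      by (auto simp: N_def)
  qed
  have N_inv: "inv t \<in> N" "(\<lambda>y. inv y) ` (D #> t) = D #> inv t" if t: "t \<in> N" for t
  proof -
    have tc: "t \<in> carrier G" using t by (simp add: N_def)
    \<comment> \<open>Finiteness turns the inclusion of the conjugate of D in D into equality, so
      the inverse of t normalises D too.\<close>
    have "inj_on (\<lambda>d. t \<otimes> d \<otimes> inv t) D"
      using tc sub by (intro inj_onI) (metis inv_closed l_cancel m_closed r_cancel subsetD)
    moreover have "(\<lambda>d. t \<otimes> d \<otimes> inv t) ` D \<subseteq> D" using t by (auto simp: N_def)
    moreover have "finite D" using fin sub finite_subset by blast
    ultimately have surj: "(\<lambda>d. t \<otimes> d \<otimes> inv t) ` D = D" by (simp add: endo_inj_surj)
    have conj_inv: "inv t \<otimes> d \<otimes> t \<in> D" if d: "d \<in> D" for d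
    proof -
      obtain d' where d': "d' \<in> D" "d = t \<otimes> d' \<otimes> inv t" using surj d by blast
      then have "inv t \<otimes> d \<otimes> t = d'" using tc sub by (auto simp: m_assoc inv_mult_cancel subsetD)
      then show ?thesis using d' by simp
    qed
    then show "inv t \<in> N" using tc by (simp add: N_def)
    show "(\<lambda>y. inv y) ` (D #> t) = D #> inv t"
    proof
      show "(\<lambda>y. inv y) ` (D #> t) \<subseteq> D #> inv t"
      proof
        fix z assume "z \<in> (\<lambda>y. inv y) ` (D #> t)"
        then obtain d where d: "d \<in> D" "z = inv (d \<otimes> t)" by (auto simp: r_coset_def)
        then have "z = (inv t \<otimes> inv d \<otimes> t) \<otimes> inv t"
          using tc sub by (auto simp: m_assoc inv_mult_group inv_mult_cancel subsetD)
        moreover have "inv t \<otimes> inv d \<otimes> t \<in> D" using conj_inv d(1) subgroup.m_inv_closed[OF D] by blast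
        ultimately show "z \<in> D #> inv t" by (auto simp: r_coset_def)
      qed
      show "D #> inv t \<subseteq> (\<lambda>y. inv y) ` (D #> t)"
      proof
        fix z assume "z \<in> D #> inv t"
        then obtain d where d: "d \<in> D" "z = d \<otimes> inv t" by (auto simp: r_coset_def)
        have "inv d \<in> D" using d(1) subgroup.m_inv_closed[OF D] by blast
        then have "t \<otimes> inv d \<otimes> inv t \<in> D" using t by (simp add: N_def)
        moreover have "z = inv (t \<otimes> inv d \<otimes> inv t \<otimes> t)"
          using d tc sub by (auto simp: m_assoc inv_mult_group inv_mult_cancel subsetD)
        ultimately show "z \<in> (\<lambda>y. inv y) ` (D #> t)" by (auto simp: r_coset_def)
      qed
    qed
  qed
  have R2_cases: "\<exists>t\<in>N. M = D #> t" if M: "M \<in> R2" for M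
  proof -
    obtain t where "t \<in> carrier G" "M = D #> t" using M R_cases unfolding R2_def R1_def by blast
    then show ?thesis using R2_iff M by blast
  qed
  have N_carrier: "t \<in> carrier G" if "t \<in> N" for t using that by (simp add: N_def)
  define F where "F = {M \<in> R2. (\<lambda>y. inv y) ` M = M}"
  have "even (card R2) \<longleftrightarrow> even (card F)"
    unfolding F_def
  proof (rule card_involution_parity)
    show "finite R2" using R(1) by (simp add: R2_def R1_def)
    fix M assume "M \<in> R2"
    then obtain t where t: "t \<in> N" "M = D #> t" using R2_cases by blast
    then show "(\<lambda>y. inv y) ` M \<in> R2" using N_inv[of t] R2_iff N_carrier by simp
    show "(\<lambda>y. inv y) ` (\<lambda>y. inv y) ` M = M"
      using t N_inv[of t] N_inv[of "inv t"] N_carrier by simp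
  qed
  then have evF: "even (card F)" using even by simp
  have "\<one> \<in> N" using sub by (auto simp: N_def)
  then have "D #> \<one> \<in> F" using R2_iff[of \<one>] N_inv(2)[of \<one>] by (simp add: F_def)
  moreover have "card F \<noteq> 1" using evF by auto
  ultimately obtain M where M: "M \<in> F" "M \<noteq> D #> \<one>"
    by (metis card_1_singleton_iff is_singletonI' is_singleton_altdef empty_iff)
  then obtain h where h: "h \<in> N" "M = D #> h" using R2_cases unfolding F_def by blast
  have hc: "h \<in> carrier G" using h(1) N_carrier by blast
  \<comment> \<open>As h normalises D, inversion sends D h to D h^-1; for the chosen coset these
    agree, which means h h in D.\<close>
  have "D #> inv h = D #> h" using M(1) h N_inv(2)[OF h(1)] by (simp add: F_def)
  then have "inv h \<otimes> inv h \<in> D" using r_coset_eq_iff[OF D, of "inv h" h] hc by simp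
  then have "inv (inv h \<otimes> inv h) \<in> D" using subgroup.m_inv_closed[OF D] by blast
  then have "h \<otimes> h \<in> D" using hc by (simp add: inv_mult_group)
  moreover have "h \<notin> D"
    using M(2) h(2) coset_join2[OF hc D] sub by auto
  ultimately show ?thesis using h(1) hc unfolding N_def by blast
qed

lemma ord_eq_2:
  assumes "x \<in> carrier G" "x \<otimes> x = \<one>" "x \<noteq> \<one>"
  shows "ord x = 2"
proof -
  have "x [^] (2::nat) = \<one>" using assms by (simp add: numeral_2_eq_2)
  then have "ord x dvd 2" using assms(1) by (simp add: pow_eq_id)
  moreover have "ord x \<noteq> 1" using ord_eq_1[OF assms(1)] assms(3) by blast
  ultimately show ?thesis by (metis prime_nat_iff two_is_prime_nat)
qed

lemma ord_eq_4:
  assumes "x \<in> carrier G" "x [^] (4::int) = \<one>" "x [^] (2::int) \<noteq> \<one>"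
  shows "ord x = 4"
proof -
  have "int (ord x) dvd int 4" "\<not> int (ord x) dvd int 2" using assms by (simp_all add: int_pow_eq_id)
  then have d: "ord x dvd 4" "\<not> ord x dvd 2" by (simp_all only: of_nat_dvd_iff simp_thms)
  then have "ord x \<le> 4" using dvd_imp_le[OF d(1)] by simp
  then have "ord x \<in> {0, 1, 2, 3, 4}" by auto
  then show ?thesis using d by auto
qed

lemma twist_int_pow:
  assumes "c \<in> carrier G" "h \<in> carrier G" "h \<otimes> c = c [^] (j::int) \<otimes> h"
  shows "h \<otimes> c [^] (i::int) = c [^] (j * i) \<otimes> h"
proof -
  have "h \<otimes> c \<otimes> inv h = c [^] j" using assms by (simp add: m_assoc)
  then have "h \<otimes> c [^] i \<otimes> inv h = c [^] (j * i)"
    using conj_int_pow[OF assms(2,1), of i] assms(1) by (simp add: int_pow_pow)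
  then have "(h \<otimes> c [^] i \<otimes> inv h) \<otimes> h = c [^] (j * i) \<otimes> h" by simp
  then show ?thesis using assms by (simp add: m_assoc)
qed

lemma range_int_pow_subgroup:
  assumes "c \<in> carrier G"
  shows "subgroup (range (\<lambda>i::int. c [^] i)) G"
    and "finite (carrier G) \<Longrightarrow> card (range (\<lambda>i::int. c [^] i)) = ord c"
proof -
  have "range (\<lambda>i::int. c [^] i) = generate G {c}"
    using generate_pow[OF assms] by auto
  then show "subgroup (range (\<lambda>i::int. c [^] i)) G"
    and "finite (carrier G) \<Longrightarrow> card (range (\<lambda>i::int. c [^] i)) = ord c"
    using assms generate_is_subgroup[of "{c}"] generate_pow_card by auto
qed

text \<open>If \<open>c\<close> is a 2-element of maximal order then \<open>h\<close> can be modified by a power of \<open>c\<close> to an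
  involution commuting with an element of order 4.\<close>

lemma no_commuting_extension:
  assumes no: "\<And>x t. x \<in> carrier G \<Longrightarrow> t \<in> carrier G \<Longrightarrow> x \<otimes> t = t \<otimes> x \<Longrightarrow>
      ord x = 4 \<Longrightarrow> ord t = 2 \<Longrightarrow> t = x \<otimes> x"
    and c: "c \<in> carrier G" "ord c = 2 ^ k" "2 \<le> k"
    and max: "\<And>g. g \<in> carrier G \<Longrightarrow> g [^] (2 ^ Suc k :: int) = \<one> \<Longrightarrow> g [^] (2 ^ k :: int) = \<one>"
    and h: "h \<in> carrier G" "h \<notin> range (\<lambda>i::int. c [^] i)"
    and norm: "h \<otimes> c = c [^] (j::int) \<otimes> h" "4 dvd j - 1"
    and sq: "h \<otimes> h = c [^] (m::int)"
  shows False
proof -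
  obtain l where l: "k = Suc (Suc l)" using c(3) by (metis add_2_eq_Suc le_Suc_ex)
  have eq_iff: "c [^] i = c [^] i' \<longleftrightarrow> 2 ^ k dvd i' - i" for i i' :: int
    using int_pow_eq[OF c(1), of i i'] by (simp add: c(2))
  have one_iff: "c [^] i = \<one> \<longleftrightarrow> 2 ^ k dvd i" for i :: int
    using eq_iff[of 0 i] by (metis diff_zero int_pow_0)
  have h_pow: "h [^] (2 * i) = c [^] (m * i)" for i :: int
  proof -
    have "h [^] (2::int) = h \<otimes> h" using h(1) int_pow_mult[of h 1 1] by simp
    then show ?thesis using h(1) c(1) sq by (metis int_pow_pow)
  qed
  \<comment> \<open>For odd m the element h would have order 2^(k+1), which \<open>max\<close>
    forbids.\<close>
  have "even m"
  proof -
    have "h [^] (2 ^ Suc k :: int) = \<one>" using h_pow[of "2 ^ k"] one_iff by simp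
    then have "h [^] (2 ^ k :: int) = \<one>" by (rule max[OF h(1)])
    then have "c [^] (m * 2 ^ Suc l) = \<one>" using h_pow[of "2 ^ Suc l"] by (simp add: l)
    then have "(2::int) ^ k dvd m * 2 ^ Suc l" by (rule one_iff[THEN iffD1])
    then have "4 dvd m * 2" by (simp add: l)
    then show ?thesis by presburger
  qed
  then obtain m' where m: "m = 2 * m'" by blast
  obtain p where p: "j = 1 + 4 * p" using norm(2) by (metis dvdE add.commute diff_add_cancel)
  have "coprime (1 + 2 * p) (2 ^ k)" by simp
  then obtain s v where s: "s * (1 + 2 * p) + v * 2 ^ k = 1"
    using bezout_int[of "1 + 2 * p" "2 ^ k"] by (metis coprime_imp_gcd_eq_1)
  \<comment> \<open>t = c^r h squares to c^(r + j r + m). With j = 1 + 4 p and m = 2 m' this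
    exponent is 2 ((1 + 2 p) r + m'), and s inverts the odd number 1 + 2 p modulo 2^k.\<close>
  define r where "r = - s * m'"
  define t where "t = c [^] r \<otimes> h"
  have t: "t \<in> carrier G" using c(1) h(1) by (simp add: t_def)
  have "t \<otimes> t = c [^] r \<otimes> (h \<otimes> c [^] r) \<otimes> h"
    using c(1) h(1) by (simp add: t_def m_assoc)
  also have "\<dots> = c [^] r \<otimes> c [^] (j * r) \<otimes> (h \<otimes> h)"
    using c(1) h(1) twist_int_pow[OF c(1) h(1) norm(1), of r] by (simp add: m_assoc)
  also have "\<dots> = c [^] (r + j * r + m)" using c(1) by (simp add: sq int_pow_mult)
  also have "\<dots> = \<one>"
  proof -
    have "(1 + 2 * p) * s - 1 = 2 ^ k * (- v)" using s by (simp add: algebra_simps)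
    then have "(2::int) ^ k dvd (1 + 2 * p) * s - 1" by (rule dvdI)
    then have "(2::int) ^ k dvd ((1 + 2 * p) * s - 1) * (- 2 * m')" by (rule dvd_mult2)
    also have "((1 + 2 * p) * s - 1) * (- 2 * m') = r + j * r + m"
      by (simp add: p m r_def algebra_simps)
    finally show ?thesis by (simp add: one_iff)
  qed
  finally have tt: "t \<otimes> t = \<one>" .
  have h_t: "h = c [^] (- r) \<otimes> t"
    using c(1) h(1) by (simp add: t_def m_assoc [symmetric] int_pow_mult [symmetric])
  then have "t \<noteq> \<one>" using h(2) c(1) by auto
  then have ord_t: "ord t = 2" using t tt by (intro ord_eq_2)
  \<comment> \<open>x has order 4, as l = k - 2, and h commutes with it because j = 1 mod 4. So
    \<open>no\<close> applies to x and t and puts t, hence h, among the powers of c.\<close>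
  define x where "x = c [^] (2 ^ l :: int)"
  have x: "x \<in> carrier G" using c(1) by (simp add: x_def)
  have "x [^] (4::int) = \<one>" "x [^] (2::int) \<noteq> \<one>"
    using c(1) by (simp_all add: x_def int_pow_pow one_iff l)
  then have ord_x: "ord x = 4" using x by (intro ord_eq_4)
  have "c [^] (j * 2 ^ l) = c [^] (2 ^ l :: int)" by (simp add: eq_iff l p algebra_simps)
  then have "h \<otimes> x = x \<otimes> h" using twist_int_pow[OF c(1) h(1) norm(1), of "2 ^ l"] by (simp add: x_def)
  moreover have "c [^] r \<otimes> x = x \<otimes> c [^] r"
    using c(1) by (simp add: x_def int_pow_mult [symmetric] add.commute)
  ultimately have "x \<otimes> t = t \<otimes> x"
    using c(1) h(1) x unfolding t_def by (metis int_pow_closed m_assoc)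
  from no[OF x t this ord_x ord_t] have "h = c [^] (- r) \<otimes> (c [^] (2 ^ l :: int) \<otimes> c [^] (2 ^ l :: int))"
    using h_t by (simp only: x_def)
  then have "h = c [^] (- r + (2 ^ l + 2 ^ l))" by (simp only: int_pow_mult c(1))
  then show False using h(2) by blast
qed

text \<open>\<open>g\<close> normalises the powers of \<open>c\<close> and its square is one of
  them, so these powers and one coset make up the group generated by \<open>c\<close> and
  \<open>g\<close>. Dihedral, semidihedral and generalised quaternion groups have this
  shape.\<close>

lemma dihedral_like_subgroup:
  fixes j n :: int
  assumes c: "c \<in> carrier G" and g: "g \<in> carrier G"
    and rel: "g \<otimes> c = c [^] j \<otimes> g" "g \<otimes> g = c [^] n"
  defines "D \<equiv> range (\<lambda>i::int. c [^] i) \<union> range (\<lambda>i::int. c [^] i \<otimes> g)"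
  shows "subgroup D G"
    and "finite (carrier G) \<Longrightarrow> g \<notin> range (\<lambda>i::int. c [^] i) \<Longrightarrow> card D = 2 * ord c"
    and "subgroup H G \<Longrightarrow> c \<in> H \<Longrightarrow> g \<in> H \<Longrightarrow> D \<subseteq> H"
proof -
  have tw: "g \<otimes> c [^] i = c [^] (j * i) \<otimes> g" for i :: int
    by (rule twist_int_pow[OF c g rel(1)])
  have mult1: "c [^] i \<otimes> g \<otimes> c [^] l = c [^] (i + j * l) \<otimes> g" for i l :: int
    using c g tw[of l] by (simp add: m_assoc int_pow_mult)
  have mult2: "c [^] i \<otimes> g \<otimes> (c [^] l \<otimes> g) = c [^] (i + j * l + n)" for i l :: int
  proof -
    have "c [^] i \<otimes> g \<otimes> (c [^] l \<otimes> g) = (c [^] i \<otimes> g \<otimes> c [^] l) \<otimes> g"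
      using c g by (simp add: m_assoc)
    also have "\<dots> = c [^] (i + j * l) \<otimes> (g \<otimes> g)"
      unfolding mult1 using c g by (simp add: m_assoc)
    finally show ?thesis using c by (simp add: rel(2) int_pow_mult)
  qed
  show "subgroup D G"
  proof (rule subgroupI)
    show "D \<subseteq> carrier G" using c g by (auto simp: D_def)
    show "D \<noteq> {}" by (auto simp: D_def)
    fix a b assume "a \<in> D" "b \<in> D"
    then consider (1) i l :: int where "a = c [^] i" "b = c [^] l"
      | (2) i l :: int where "a = c [^] i" "b = c [^] l \<otimes> g"
      | (3) i l :: int where "a = c [^] i \<otimes> g" "b = c [^] l"
      | (4) i l :: int where "a = c [^] i \<otimes> g" "b = c [^] l \<otimes> g"
      by (auto simp: D_def)
    then show "a \<otimes> b \<in> D"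
    proof cases
      case 1
      then have "a \<otimes> b = c [^] (i + l)" using c by (simp add: int_pow_mult)
      then show ?thesis by (simp add: D_def)
    next
      case 2
      then have "a \<otimes> b = c [^] (i + l) \<otimes> g" using c g by (simp add: int_pow_mult m_assoc)
      then show ?thesis by (simp add: D_def)
    next
      case 3
      then have "a \<otimes> b = c [^] (i + j * l) \<otimes> g" by (simp add: mult1)
      then show ?thesis by (simp add: D_def)
    next
      case 4
      then have "a \<otimes> b = c [^] (i + j * l + n)" by (simp add: mult2)
      then show ?thesis by (simp add: D_def)
    qed
  next
    fix a assume "a \<in> D"
    then consider (1) i :: int where "a = c [^] i" | (2) i :: int where "a = c [^] i \<otimes> g"
      by (auto simp: D_def)
    then show "inv a \<in> D"
    proof cases
      case 1
      then have "inv a = c [^] (- i)" using c by (simp add: int_pow_neg)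
      then show ?thesis by (simp add: D_def)
    next
      case 2
      \<comment> \<open>The exponent a = - n - j i solves a + j i + n = 0, the exponent in
        \<open>mult2\<close>.\<close>
      have "c [^] (- n - j * i) \<otimes> g \<otimes> a = \<one>"
      proof -
        have "c [^] (- n - j * i) \<otimes> g \<otimes> a = c [^] (- n - j * i + j * i + n)"
          unfolding 2 by (rule mult2)
        then show ?thesis by simp
      qed
      then have "inv a = c [^] (- n - j * i) \<otimes> g"
        using 2 c g by (intro inv_equality) auto
      then show ?thesis by (simp add: D_def)
    qed
  qed
  show "card D = 2 * ord c" if fin: "finite (carrier G)" and gC: "g \<notin> range (\<lambda>i::int. c [^] i)"
  proof -
    let ?C = "range (\<lambda>i::int. c [^] i)"
    have C: "subgroup ?C G" "card ?C = ord c" using range_int_pow_subgroup[OF c] fin by auto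
    have sub: "?C \<subseteq> carrier G" using c by auto
    have "range (\<lambda>i::int. c [^] i \<otimes> g) = ?C #> g" by (auto simp: r_coset_def)
    moreover have "card (?C #> g) = ord c"
      using card_rcosets_equal[OF rcosetsI[OF sub g] sub] C(2) by simp
    moreover have "?C \<inter> (?C #> g) = {}"
    proof (rule ccontr)
      assume "?C \<inter> (?C #> g) \<noteq> {}"
      then obtain i l :: int where "c [^] i = c [^] l \<otimes> g" by (auto simp: r_coset_def)
      then have "g = c [^] (i - l)"
        using c g by (metis int_pow_closed int_pow_diff int_pow_mult add.commute diff_add_cancel l_cancel)
      then show False using gC by blast
    qed
    moreover have "finite ?C" "finite (?C #> g)"
      using fin sub g finite_subset r_coset_subset_G by blast+
    ultimately show ?thesis using C(2) by (simp add: D_def card_Un_disjoint)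
  qed
  show "D \<subseteq> H" if "subgroup H G" "c \<in> H" "g \<in> H"
    using that subgroup.m_closed subgroup_int_pow_closed by (fastforce simp: D_def)
qed

text \<open>If h acts on the powers of c with exponent 1 mod 4, so does h h, whereas the elements of
  the coset of g act with exponent 3 mod 4. Hence h h is a power of c and
  \<open>no_commuting_extension\<close> applies. If h acts with exponent 3 mod 4, then h g acts with
  exponent 1 mod 4 and replaces h.\<close>

lemma no_dihedral_extension:
  assumes no: "\<And>x t. x \<in> carrier G \<Longrightarrow> t \<in> carrier G \<Longrightarrow> x \<otimes> t = t \<otimes> x \<Longrightarrow>
      ord x = 4 \<Longrightarrow> ord t = 2 \<Longrightarrow> t = x \<otimes> x"
    and c: "c \<in> carrier G" "ord c = 2 ^ k" "2 \<le> k"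
    and max: "\<And>g. g \<in> carrier G \<Longrightarrow> g [^] (2 ^ Suc k :: int) = \<one> \<Longrightarrow> g [^] (2 ^ k :: int) = \<one>"
    and g: "g \<in> carrier G" "g \<otimes> c = c [^] (j::int) \<otimes> g" "4 dvd j - 3" "g \<otimes> g = c [^] (n::int)"
    and D: "D = range (\<lambda>i::int. c [^] i) \<union> range (\<lambda>i::int. c [^] i \<otimes> g)"
    and h: "h \<in> carrier G" "h \<notin> D" "\<And>d. d \<in> D \<Longrightarrow> h \<otimes> d \<otimes> inv h \<in> D" "h \<otimes> h \<in> D"
    and norm: "h \<otimes> c = c [^] (l::int) \<otimes> h"
  shows False
proof -
  have eq_iff: "c [^] i = c [^] i' \<longleftrightarrow> 2 ^ k dvd i' - i" for i i' :: int
    using int_pow_eq[OF c(1), of i i'] by (simp add: c(2))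
  have subD: "subgroup D G" unfolding D by (rule dihedral_like_subgroup(1)[OF c(1) g(1,2,4)])
  have four: "(4::int) dvd 2 ^ k" using c(3) le_imp_power_dvd[of 2 k "2::int"] by simp
  have gD: "g \<in> D"
  proof -
    have "g = c [^] (0::int) \<otimes> g" using g(1) by simp
    then show ?thesis unfolding D by blast
  qed
  have centralizing: False
    if h': "h' \<in> carrier G" "h' \<notin> D" "h' \<otimes> h' \<in> D" and l': "h' \<otimes> c = c [^] (l'::int) \<otimes> h'" "4 dvd l' - 1" for h' l'
  proof -
    have "h' \<otimes> h' \<notin> range (\<lambda>i::int. c [^] i \<otimes> g)"
    proof
      assume "h' \<otimes> h' \<in> range (\<lambda>i::int. c [^] i \<otimes> g)"
      then obtain i :: int where i: "h' \<otimes> h' = c [^] i \<otimes> g" by blast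
      have "h' \<otimes> h' \<otimes> c = h' \<otimes> (c [^] l' \<otimes> h')" using c(1) h'(1) l'(1) by (simp add: m_assoc)
      also have "\<dots> = (h' \<otimes> c [^] l') \<otimes> h'" using c(1) h'(1) by (simp add: m_assoc)
      also have "\<dots> = c [^] (l' * l') \<otimes> (h' \<otimes> h')"
        unfolding twist_int_pow[OF c(1) h'(1) l'(1)] using c(1) h'(1) by (simp add: m_assoc)
      finally have 1: "h' \<otimes> h' \<otimes> c = c [^] (l' * l') \<otimes> (h' \<otimes> h')" .
      have "h' \<otimes> h' \<otimes> c = c [^] i \<otimes> (c [^] j \<otimes> g)" unfolding i using c(1) g(1,2) by (simp add: m_assoc)
      also have "\<dots> = c [^] (i + j) \<otimes> g" using c(1) g(1) by (simp add: m_assoc [symmetric] int_pow_mult)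
      also have "\<dots> = c [^] (j + i) \<otimes> g" by (simp only: add.commute)
      also have "\<dots> = c [^] j \<otimes> (h' \<otimes> h')" unfolding i using c(1) g(1) by (simp add: int_pow_mult m_assoc)
      finally have "c [^] (l' * l') = c [^] j" using 1 c(1) h'(1) by simp
      then have "4 dvd j - l' * l'" using four by (metis eq_iff dvd_trans)
      moreover obtain p where "l' = 1 + 4 * p" using l'(2) by (metis dvdE add.commute diff_add_cancel)
      then have "l' * l' = 1 + 4 * (p * (2 + 4 * p))" by (simp add: algebra_simps)
      ultimately have "4 dvd j - (1 + 4 * (p * (2 + 4 * p)))" by simp
      then have "4 dvd j - 1" by presburger
      then show False using g(3) by presburger
    qed
    then obtain m :: int where "h' \<otimes> h' = c [^] m" using h'(3) unfolding D by blast
    moreover have "h' \<notin> range (\<lambda>i::int. c [^] i)" using h'(2) unfolding D by blast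
    ultimately show False using no_commuting_extension[OF no c max h'(1) _ l'] by blast
  qed
  \<comment> \<open>An even l would make conjugation by h send c^(2^(k-1)), which is not 1, to
    1.\<close>
  have "odd l"
  proof
    assume "even l"
    then obtain l0 where l0: "l = 2 * l0" by blast
    obtain k0 where k0: "k = Suc k0" using c(3) by (cases k) auto
    have "c [^] (l * 2 ^ k0) = c [^] (0::int)" unfolding eq_iff by (simp add: l0 k0)
    then have "h \<otimes> c [^] (2 ^ k0 :: int) = h"
      unfolding twist_int_pow[OF c(1) h(1) norm] using h(1) by simp
    then have "c [^] (2 ^ k0 :: int) = c [^] (0::int)" using c(1) h(1) by simp
    then show False unfolding eq_iff by (simp add: k0)
  qed
  then have "4 dvd l - 1 \<or> 4 dvd l - 3" by presburger
  then consider "4 dvd l - 1" | "4 dvd l - 3" by blast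
  then show False
  proof cases
    case 1
    then show False using centralizing[OF h(1,2,4) norm] by blast
  next
    case 2
    have hg: "h \<otimes> g \<otimes> c = c [^] (l * j) \<otimes> (h \<otimes> g)"
    proof -
      have "h \<otimes> g \<otimes> c = (h \<otimes> c [^] j) \<otimes> g" using c(1) g(1,2) h(1) by (simp add: m_assoc)
      then show ?thesis unfolding twist_int_pow[OF c(1) h(1) norm] using c(1) g(1) h(1) by (simp add: m_assoc)
    qed
    moreover have "h \<otimes> g \<notin> D"
    proof
      assume "h \<otimes> g \<in> D"
      then have "h \<otimes> g \<otimes> inv g \<in> D" using subgroup.m_closed[OF subD] subgroup.m_inv_closed[OF subD gD] by blast
      then show False using h(1,2) g(1) by (simp add: m_assoc)
    qed
    moreover have "h \<otimes> g \<otimes> (h \<otimes> g) \<in> D"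
    proof -
      have "h \<otimes> g \<otimes> (h \<otimes> g) = (h \<otimes> g \<otimes> inv h) \<otimes> (h \<otimes> h) \<otimes> g"
        using h(1) g(1) by (simp add: m_assoc inv_mult_cancel)
      then show ?thesis using h(3)[OF gD] h(4) gD subgroup.m_closed[OF subD] by metis
    qed
    moreover have "4 dvd l * j - 1"
    proof -
      obtain p where "l = 3 + 4 * p" using 2 by (metis dvdE add.commute diff_add_cancel)
      moreover obtain q where "j = 3 + 4 * q" using g(3) by (metis dvdE add.commute diff_add_cancel)
      ultimately have "l * j - 1 = 4 * (2 + 3 * p + 3 * q + 4 * p * q)" by (simp add: algebra_simps)
      then show ?thesis by (rule dvdI)
    qed
    ultimately show False using centralizing[of "h \<otimes> g"] h(1) g(1) by blast
  qed
qed

text \<open>If the index of the powers of c is even, \<open>normalizer_growth\<close> adds an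
  element g, which must act with exponent 3 mod 4. If 4 divides the index, a second growth step adds
  h normalising D, the group generated by c and g. \<open>no_dihedral_extension\<close> excludes an
  h that normalises the powers of c; otherwise D has a second cyclic subgroup of order 2^k and is
  the quaternion group of order 8.\<close>

lemma cyclic_subgroup_small_index:
  assumes fin: "finite (carrier G)"
    and no: "\<And>x t. x \<in> carrier G \<Longrightarrow> t \<in> carrier G \<Longrightarrow> x \<otimes> t = t \<otimes> x \<Longrightarrow>
      ord x = 4 \<Longrightarrow> ord t = 2 \<Longrightarrow> t = x \<otimes> x"
    and c: "c \<in> carrier G" "ord c = 2 ^ k" "2 \<le> k"
    and max: "\<And>g. g \<in> carrier G \<Longrightarrow> g [^] (2 ^ Suc k :: int) = \<one> \<Longrightarrow> g [^] (2 ^ k :: int) = \<one>"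
  shows "\<not> 2 ^ Suc k dvd order G \<or>
    (\<exists>g\<in>carrier G. \<exists>j::int. g \<otimes> c = c [^] j \<otimes> g \<and> 4 dvd j - 3) \<and> \<not> 2 ^ Suc (Suc k) dvd order G"
proof (cases "2 ^ Suc k dvd order G")
  case True
  let ?C = "range (\<lambda>i::int. c [^] i)"
  have eq_iff: "c [^] i = c [^] i' \<longleftrightarrow> 2 ^ k dvd i' - i" for i i' :: int
    using int_pow_eq[OF c(1), of i i'] by (simp add: c(2))
  have one_iff: "c [^] i = \<one> \<longleftrightarrow> 2 ^ k dvd i" for i :: int
    using eq_iff[of 0 i] by (metis diff_zero int_pow_0)
  have c_C: "c \<in> ?C" using c(1) by (metis int_pow_1 rangeI)
  have c_pow: "c [^] ((2::nat) ^ k) = \<one>" using c(1,2) pow_ord_eq_1 by metis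
  have "\<exists>h\<in>carrier G. h \<notin> ?C \<and> (\<forall>d\<in>?C. h \<otimes> d \<otimes> inv h \<in> ?C) \<and> h \<otimes> h \<in> ?C"
  \<comment> \<open>In the cyclic case c itself serves as the second generator, with exponent
    1.\<close>
  proof (rule normalizer_growth[OF fin _ _ c_C c_C c_pow c_pow])
    show "subgroup ?C G" using range_int_pow_subgroup[OF c(1)] by blast
    show "2 * card ?C dvd order G" using True range_int_pow_subgroup(2)[OF c(1) fin] c(2) by simp
    show "c \<otimes> c = c [^] (1::int) \<otimes> c" using c(1) by simp
    show "?C \<subseteq> H" if "subgroup H G" "c \<in> H" for H using that subgroup_int_pow_closed by auto
  qed
  then obtain g where g: "g \<in> carrier G" "g \<notin> ?C" "g \<otimes> c \<otimes> inv g \<in> ?C" "g \<otimes> g \<in> ?C"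
    using c_C by blast
  obtain j :: int where "g \<otimes> c \<otimes> inv g = c [^] j" using g(3) by blast
  then have "g \<otimes> c \<otimes> inv g \<otimes> g = c [^] j \<otimes> g" by simp
  then have gc: "g \<otimes> c = c [^] j \<otimes> g" using g(1) c(1) by (simp add: m_assoc)
  obtain n :: int where gg: "g \<otimes> g = c [^] n" using g(4) by blast
  obtain k0 where k0: "k = Suc k0" using c(3) by (cases k) auto
  have "odd j"
  proof
    assume "even j"
    then obtain j0 where j0: "j = 2 * j0" by blast
    have "c [^] (j * 2 ^ k0) = c [^] (0::int)" unfolding eq_iff by (simp add: j0 k0)
    then have "g \<otimes> c [^] (2 ^ k0 :: int) = g"
      unfolding twist_int_pow[OF c(1) g(1) gc] using g(1) by simp
    then have "c [^] (2 ^ k0 :: int) = c [^] (0::int)" using c(1) g(1) by simp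
    then show False unfolding eq_iff by (simp add: k0)
  qed
  moreover have "\<not> 4 dvd j - 1" using no_commuting_extension[OF no c max g(1,2) gc _ gg] by blast
  ultimately have j3: "4 dvd j - 3" by presburger
  have "\<not> 2 ^ Suc (Suc k) dvd order G"
  proof
    assume div: "2 ^ Suc (Suc k) dvd order G"
    define D where "D = ?C \<union> range (\<lambda>i::int. c [^] i \<otimes> g)"
    note D = dihedral_like_subgroup[OF c(1) g(1) gc gg, folded D_def]
    have cD: "c \<in> D" using c_C by (simp add: D_def)
    have gD: "g \<in> D"
    proof -
      have "g = c [^] (0::int) \<otimes> g" using g(1) by simp
      then show ?thesis unfolding D_def by blast
    qed
    have cardD: "card D = 2 ^ Suc k" using D(2)[OF fin g(2)] c(2) by simp
    have g_pow: "g [^] ((2::nat) ^ Suc k) = \<one>"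
    proof -
      have "g [^] ((2::nat) ^ Suc k) = (g [^] (2::nat)) [^] ((2::nat) ^ k)"
        using g(1) by (simp add: nat_pow_pow)
      also have "g [^] (2::nat) = c [^] n" using g(1) gg by (simp add: numeral_2_eq_2)
      also have "(c [^] n) [^] ((2::nat) ^ k) = c [^] (n * 2 ^ k)"
        using c(1) int_pow_pow[of c n "int (2 ^ k)"] by (simp only: int_pow_int) simp
      also have "\<dots> = \<one>" by (simp add: one_iff)
      finally show ?thesis .
    qed
    have "2 * card D dvd order G" using div by (simp add: cardD)
    from normalizer_growth[OF fin D(1) this cD gD c_pow g_pow gc D(3)]
    obtain h where h: "h \<in> carrier G" "h \<notin> D" "\<And>d. d \<in> D \<Longrightarrow> h \<otimes> d \<otimes> inv h \<in> D" "h \<otimes> h \<in> D"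
      by blast
    define y where "y = h \<otimes> c \<otimes> inv h"
    have y: "y \<in> carrier G" "y \<in> D" using h cD c(1) by (simp_all add: y_def)
    have hc: "h \<otimes> c = y \<otimes> h" using h(1) c(1) by (simp add: y_def m_assoc)
    show False
    proof (cases "y \<in> ?C")
      case True
      then obtain l :: int where "y = c [^] l" by blast
      then show False using no_dihedral_extension[OF no c max g(1) gc j3 gg D_def h] hc by blast
    next
      case False
      then obtain i :: int where i: "y = c [^] i \<otimes> g" using y(2) by (auto simp: D_def)
      have yc: "y \<otimes> c = c [^] j \<otimes> y"
      proof -
        have "y \<otimes> c = c [^] i \<otimes> c [^] j \<otimes> g" unfolding i using c(1) g(1) gc by (simp add: m_assoc)
        also have "c [^] i \<otimes> c [^] j = c [^] j \<otimes> c [^] i" using c(1) by (simp add: int_pow_mult [symmetric] add.commute)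
        finally show ?thesis unfolding i using c(1) g(1) by (simp add: m_assoc)
      qed
      define n' where "n' = i + j * i + n"
      have yy: "y \<otimes> y = c [^] n'"
      proof -
        have "y \<otimes> y = c [^] i \<otimes> (g \<otimes> c [^] i) \<otimes> g" unfolding i using c(1) g(1) by (simp add: m_assoc)
        also have "\<dots> = c [^] i \<otimes> c [^] (j * i) \<otimes> (g \<otimes> g)"
          unfolding twist_int_pow[OF c(1) g(1) gc] using c(1) g(1) by (simp add: m_assoc)
        also have "\<dots> = c [^] n'" using c(1) by (simp add: gg n'_def int_pow_mult)
        finally show ?thesis .
      qed
      \<comment> \<open>y commutes with y^2 = c^n', yet acts on powers of c with exponent j = 3 mod
        4. So c^n' has order at most 2 and y^4 = 1; as c is conjugate to y, this forces k =
        2.\<close>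
      have "y \<otimes> (y \<otimes> y) = (y \<otimes> y) \<otimes> y" using y(1) by (simp add: m_assoc)
      then have "c [^] (j * n') \<otimes> y = c [^] n' \<otimes> y"
        unfolding yy twist_int_pow[OF c(1) y(1) yc] .
      then have "c [^] (j * n') = c [^] n'" using c(1) y(1) by simp
      then have "2 ^ k dvd n' - j * n'" by (simp add: eq_iff)
      moreover obtain q where q: "j = 3 + 4 * q" using j3 by (metis dvdE add.commute diff_add_cancel)
      have "n' - j * n' = 2 * (- n' * (1 + 2 * q))" by (simp add: q algebra_simps)
      ultimately have "2 ^ k0 dvd n' * (1 + 2 * q)" by (simp add: k0)
      moreover have "coprime ((2::int) ^ k0) (1 + 2 * q)" by simp
      ultimately have n'_dvd: "2 ^ k0 dvd n'" by (simp add: coprime_dvd_mult_left_iff)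
      have conj_pow: "h \<otimes> c [^] i \<otimes> inv h = y [^] i" for i :: int
        unfolding y_def by (rule conj_int_pow[OF h(1) c(1)])
      have y2: "y [^] (2::int) = y \<otimes> y" using y(1) int_pow_mult[of y 1 1] by simp
      have "y [^] (4::int) = c [^] (n' * 2)"
        using y(1) c(1) int_pow_pow[of y 2 2] by (simp add: y2 yy int_pow_pow)
      also have "\<dots> = \<one>" using n'_dvd by (simp add: one_iff k0)
      finally have "h \<otimes> c [^] (4::int) \<otimes> inv h = \<one>" by (simp add: conj_pow)
      then have "c [^] (4::int) = \<one>"
        using h(1) c(1) by (metis int_pow_closed inv_equality inv_inv inv_closed l_cancel_one' m_closed r_inv)
      then have "(2::int) ^ k dvd 4" by (simp add: one_iff)
      then have "(2::int) ^ k \<le> 2 ^ 2" using zdvd_imp_le[of "2 ^ k" 4] by simp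
      then have "k \<le> 2" by (rule power_le_imp_le_exp[rotated]) simp
      then have k2: "k = 2" using c(3) by simp
      have "\<not> 4 dvd n'"
      proof
        assume "4 dvd n'"
        then have "y [^] (2::int) = \<one>" by (simp add: y2 yy one_iff k2)
        then have "h \<otimes> c [^] (2::int) \<otimes> inv h = \<one>" by (simp add: conj_pow)
        then have "c [^] (2::int) = \<one>"
          using h(1) c(1) by (metis int_pow_closed inv_equality inv_inv inv_closed l_cancel_one' m_closed r_inv)
        then show False by (simp add: one_iff k2)
      qed
      moreover have "even n'" using n'_dvd k2 k0 by simp
      ultimately have "4 dvd 2 - n'" by presburger
      then have yy2: "y \<otimes> y = c [^] (2::int)" by (simp add: yy eq_iff k2)
      have cj: "c [^] j = c [^] (3::int)" using j3 by (simp add: eq_iff k2) presburger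
      txt \<open>Here \<open>D\<close> is a quaternion group of order 8 in which \<open>h\<close> exchanges two of the three cyclic
        subgroups of order 4; \<open>w\<close> generates the third one, which is normalised by \<open>h\<close>.\<close>
      define w where "w = c \<otimes> y"
      have w: "w \<in> carrier G" using c(1) y(1) by (simp add: w_def)
      have ww: "w \<otimes> w = c [^] (2::int)"
      proof -
        have "w \<otimes> w = c \<otimes> (y \<otimes> c) \<otimes> y" using c(1) y(1) by (simp add: w_def m_assoc)
        also have "\<dots> = (c [^] (1::int) \<otimes> c [^] (3::int)) \<otimes> (y \<otimes> y)"
          unfolding yc cj using c(1) y(1) by (simp add: m_assoc)
        also have "c [^] (1::int) \<otimes> c [^] (3::int) = c [^] (4::int)" using c(1) by (subst int_pow_mult [symmetric]) auto
        finally show ?thesis using c(1) \<open>c [^] (4::int) = \<one>\<close> by (simp add: yy2)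
      qed
      have w2: "w [^] (2::int) = c [^] (2::int)"
        unfolding ww [symmetric] using w int_pow_mult[of w 1 1] by simp
      have w4: "w [^] (4::int) = \<one>"
        using w c(1) int_pow_pow[of w 2 2] \<open>c [^] (4::int) = \<one>\<close> by (simp add: w2 int_pow_pow)
      have ordw: "ord w = 2 ^ k"
        using ord_eq_4[OF w w4] by (simp add: w2 one_iff k2)
      have w3: "w [^] (3::int) = c [^] (3::int) \<otimes> y"
      proof -
        have "w [^] (3::int) = w [^] (2::int) \<otimes> w" using w int_pow_mult[of w 2 1] by simp
        also have "\<dots> = c [^] (2::int) \<otimes> c [^] (1::int) \<otimes> y" unfolding w2 using c(1) y(1) by (simp add: w_def m_assoc)
        also have "c [^] (2::int) \<otimes> c [^] (1::int) = c [^] (3::int)" using c(1) by (subst int_pow_mult [symmetric]) auto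
        finally show ?thesis .
      qed
      have cw: "c \<otimes> w = w [^] (3::int) \<otimes> c"
      proof -
        have "w [^] (3::int) \<otimes> c = c [^] (3::int) \<otimes> c [^] (3::int) \<otimes> y"
          unfolding w3 using c(1) y(1) yc cj by (simp add: m_assoc)
        also have "c [^] (3::int) \<otimes> c [^] (3::int) = c [^] (2::int)"
          using c(1) by (subst int_pow_mult [symmetric]) (auto simp: eq_iff k2)
        also have "c [^] (2::int) = c \<otimes> c" using c(1) int_pow_mult[of c 1 1] by simp
        finally have "w [^] (3::int) \<otimes> c = c \<otimes> c \<otimes> y" .
        moreover have "c \<otimes> w = c \<otimes> c \<otimes> y" using c(1) y(1) by (simp add: w_def m_assoc)
        ultimately show ?thesis by simp
      qed
      have cc: "c \<otimes> c = w [^] (2::int)" using c(1) int_pow_mult[of c 1 1] by (simp add: w2)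
      have c_notin: "c \<notin> range (\<lambda>i::int. w [^] i)"
      proof
        assume "c \<in> range (\<lambda>i::int. w [^] i)"
        then obtain i :: int where "c = w [^] i" by blast
        then have "c \<otimes> w = w \<otimes> c" using w int_pow_mult[of w i 1] int_pow_mult[of w 1 i] by (simp add: add.commute)
        then have "w [^] (3::int) = w [^] (1::int)" using cw w c(1) by simp
        then show False using int_pow_eq[OF w, of 3 1] by (simp add: ordw k2)
      qed
      \<comment> \<open>D is rewritten with w as the cyclic generator and c as the outer one, the
        form in which \<open>no_dihedral_extension\<close> excludes h.\<close>
      define D' where "D' = range (\<lambda>i::int. w [^] i) \<union> range (\<lambda>i::int. w [^] i \<otimes> c)"
      note D' = dihedral_like_subgroup[OF w c(1) cw cc, folded D'_def]
      have "D' \<subseteq> D" using D'(3)[OF D(1) _ cD] subgroup.m_closed[OF D(1) cD y(2)] by (simp add: w_def)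
      moreover have "card D' = card D" using D'(2)[OF fin c_notin] by (simp add: ordw cardD)
      moreover have "finite D" using fin finite_subset[OF subgroup.subset[OF D(1)]] by blast
      ultimately have DD': "D' = D" by (metis card_subset_eq)
      \<comment> \<open>Conjugation by h sends c to y, and w = c y to y times the conjugate of c by
        h h. Since h h lies in D, that conjugate is c or c^3, and the result is w^3 or w.\<close>
      have hw: "\<exists>l::int. h \<otimes> w = w [^] l \<otimes> h"
      proof -
        have hhc: "h \<otimes> h \<otimes> c = c \<otimes> (h \<otimes> h) \<or> h \<otimes> h \<otimes> c = c [^] (3::int) \<otimes> (h \<otimes> h)"
        proof (cases "h \<otimes> h \<in> ?C")
          case True
          then obtain a :: int where "h \<otimes> h = c [^] a" by blast
          then show ?thesis using c(1) int_pow_mult[of c a 1] int_pow_mult[of c 1 a] by (simp add: add.commute)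
        next
          case False
          then obtain a :: int where a: "h \<otimes> h = c [^] a \<otimes> g" using h(4) by (auto simp: D_def)
          have "c [^] a \<otimes> g \<otimes> c = c [^] a \<otimes> c [^] (3::int) \<otimes> g" using c(1) g(1) gc cj by (simp add: m_assoc)
          also have "c [^] a \<otimes> c [^] (3::int) = c [^] (3::int) \<otimes> c [^] a"
            using c(1) by (simp add: int_pow_mult [symmetric] add.commute)
          finally show ?thesis unfolding a using c(1) g(1) by (simp add: m_assoc)
        qed
        have "h \<otimes> w = y \<otimes> (h \<otimes> y)" unfolding w_def using hc h(1) c(1) y(1) by (simp add: m_assoc [symmetric])
        also have "h \<otimes> y = h \<otimes> h \<otimes> c \<otimes> inv h" using h(1) c(1) by (simp add: y_def m_assoc)
        finally have hw: "h \<otimes> w = y \<otimes> (h \<otimes> h \<otimes> c \<otimes> inv h)" .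
        from hhc show ?thesis
        proof
          assume "h \<otimes> h \<otimes> c = c \<otimes> (h \<otimes> h)"
          then have "h \<otimes> w = y \<otimes> (c \<otimes> (h \<otimes> h) \<otimes> inv h)" using hw by simp
          also have "\<dots> = (y \<otimes> c) \<otimes> h" using h(1) c(1) y(1) by (simp add: m_assoc)
          also have "\<dots> = w [^] (3::int) \<otimes> h" unfolding yc cj w3 ..
          finally show ?thesis by blast
        next
          assume "h \<otimes> h \<otimes> c = c [^] (3::int) \<otimes> (h \<otimes> h)"
          then have "h \<otimes> w = y \<otimes> (c [^] (3::int) \<otimes> (h \<otimes> h) \<otimes> inv h)" using hw by simp
          also have "\<dots> = (y \<otimes> c [^] (3::int)) \<otimes> h" using h(1) c(1) y(1) by (simp add: m_assoc)
          also have "y \<otimes> c [^] (3::int) = c [^] (j * 3) \<otimes> y" by (rule twist_int_pow[OF c(1) y(1) yc])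
          also have "c [^] (j * 3) = c [^] (1::int)" using j3 by (simp add: eq_iff k2) presburger
          finally have "h \<otimes> w = w [^] (1::int) \<otimes> h" using c(1) w by (simp add: w_def)
          then show ?thesis by blast
        qed
      qed
      then obtain l :: int where l: "h \<otimes> w = w [^] l \<otimes> h" by blast
      have Dw: "D = range (\<lambda>i::int. w [^] i) \<union> range (\<lambda>i::int. w [^] i \<otimes> c)"
        unfolding DD' [symmetric] D'_def ..
      have "(4::int) dvd 3 - 3" by simp
      from no_dihedral_extension[OF no w ordw c(3) max c(1) cw this cc Dw h l] show False by blast
    qed
  qed
  then show ?thesis using g(1) gc j3 by blast
qed simp

section \<open>The group C4 x C2 inside G and inside V(ZG)\<close>

text \<open>The only involution among the powers of \<open>x\<close> is its square, so
  \<open>t\<close> is not a power of \<open>x\<close> and the map (i, j) |-> x^i t^j is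
  injective.\<close>

lemma C4xC2_subgroupI:
  assumes x: "x \<in> carrier G" "ord x = 4" and t: "t \<in> carrier G" "ord t = 2"
    and comm: "x \<otimes> t = t \<otimes> x" and ne: "t \<noteq> x \<otimes> x"
  shows "\<exists>K. subgroup K G \<and> G\<lparr>carrier := K\<rparr> \<cong> C4xC2"
proof -
  define f where "f p = x [^] (fst p) \<otimes> t [^] (snd p)" for p :: "int \<times> int"
  have x_eq: "x [^] i = x [^] j \<longleftrightarrow> 4 dvd j - i" for i j :: int
    using int_pow_eq[OF x(1)] x(2) by simp
  have t_eq: "t [^] i = t [^] j \<longleftrightarrow> 2 dvd j - i" for i j :: int
    using int_pow_eq[OF t(1)] t(2) by simp
  have grp: "group C4xC2" unfolding C4xC2_def by (intro DirProd_group) simp_all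
  have carr: "carrier C4xC2 = {0..<4} \<times> {0..<2}"
    by (simp add: C4xC2_def carrier_integer_mod_group)
  have xt: "x [^] i \<otimes> t [^] j = t [^] j \<otimes> x [^] i" for i j :: int
  proof -
    have "t \<otimes> x = x [^] (1::int) \<otimes> t" using comm x(1) by simp
    from twist_int_pow[OF x(1) t(1) this, of i]
    have "x [^] i \<otimes> t = t [^] (1::int) \<otimes> x [^] i" using t(1) by simp
    from twist_int_pow[OF t(1) _ this, of j] show ?thesis using x(1) by simp
  qed
  have hom: "f \<in> hom C4xC2 G"
  proof (rule homI)
    show "f p \<in> carrier G" for p using x(1) t(1) by (simp add: f_def)
    fix p q :: "int \<times> int"
    obtain i j i' j' where pq: "p = (i, j)" "q = (i', j')" by (cases p, cases q)
    have "f (p \<otimes>\<^bsub>C4xC2\<^esub> q) = x [^] ((i + i') mod 4) \<otimes> t [^] ((j + j') mod 2)"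
      by (simp add: f_def pq C4xC2_def)
    also have "x [^] ((i + i') mod 4) = x [^] (i + i')" by (simp add: x_eq minus_mod_eq_mult_div)
    also have "t [^] ((j + j') mod 2) = t [^] (j + j')" by (simp add: t_eq minus_mod_eq_mult_div)
    also have "x [^] (i + i') \<otimes> t [^] (j + j') = x [^] i \<otimes> (x [^] i' \<otimes> t [^] j) \<otimes> t [^] j'"
      using x(1) t(1) by (simp add: int_pow_mult m_assoc)
    also have "\<dots> = f p \<otimes> f q"
      unfolding xt[of i' j] using x(1) t(1) by (simp add: f_def pq m_assoc)
    finally show "f (p \<otimes>\<^bsub>C4xC2\<^esub> q) = f p \<otimes> f q" .
  qed
  interpret f: group_hom C4xC2 G f
    by (intro group_hom.intro group_hom_axioms.intro grp is_group hom)
  have inj: "inj_on f (carrier C4xC2)"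
    unfolding f.inj_on_one_iff
  proof (intro allI impI)
    fix p assume p: "p \<in> carrier C4xC2" "f p = \<one>"
    obtain i j where ij: "p = (i, j)" by (cases p)
    have range: "0 \<le> i" "i < 4" "j = 0 \<or> j = 1" using p(1) by (auto simp: carr ij)
    from range(3) have "p = (0, 0)"
    proof
      assume j: "j = 0"
      then have "x [^] i = x [^] (0::int)" using p(2) x(1) by (simp add: f_def ij)
      then have "4 dvd 0 - i" unfolding x_eq .
      then have "4 dvd i" by simp
      then show ?thesis using range j ij by (auto dest: zdvd_imp_le)
    next
      assume j: "j = 1"
      then have "x [^] i \<otimes> t = \<one>" using p(2) t(1) by (simp add: f_def ij)
      then have "inv t = x [^] i" using x(1) t(1) by (intro inv_equality) auto
      moreover have "inv t = t" using t_eq[of "-1" 1] t(1) by (simp add: int_pow_neg)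
      ultimately have tx: "t = x [^] i" by simp
      have "t [^] (2::int) = t [^] (0::int)" by (simp only: t_eq) simp
      then have "x [^] (i * 2) = x [^] (0::int)" using x(1) by (simp add: tx int_pow_pow)
      then have "4 dvd 0 - i * 2" unfolding x_eq .
      then have "i = 0 \<or> i = 2" using range by presburger
      moreover have "i \<noteq> 0" using tx t by auto
      moreover have "i \<noteq> 2" using tx ne int_pow_mult[of x 1 1] x(1) by auto
      ultimately show ?thesis by blast
    qed
    then show "p = \<one>\<^bsub>C4xC2\<^esub>" by (simp add: C4xC2_def)
  qed
  define K where "K = f ` carrier C4xC2"
  have K: "subgroup K G" unfolding K_def by (rule f.img_is_subgroup)
  have "f \<in> iso C4xC2 (G\<lparr>carrier := K\<rparr>)"
    using inj hom by (auto simp: iso_def hom_def bij_betw_def K_def)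
  then have "C4xC2 \<cong> G\<lparr>carrier := K\<rparr>" by (auto simp: is_iso_def)
  then show ?thesis using K group.iso_sym[OF grp] by blast
qed

lemma group_ring_one_left:
  assumes "finite (carrier G)" "u \<in> group_ring_elems G"
  shows "group_ring_mult G (group_ring_one G) u = u"
proof
  fix x
  show "group_ring_mult G (group_ring_one G) u x = u x"
    using assms
    by (auto simp: group_ring_mult_def group_ring_one_def group_ring_elems_def
        if_distrib[of "\<lambda>t. t * _"] cong: if_cong)
qed

text \<open>The elements of \<open>H\<close> are indexed by all pairs of integers, read modulo 4 and
  2, so that products become sums of indices without reduction.\<close>

lemma C4xC2_units:
  assumes fin: "finite (carrier G)"
    and H: "subgroup H (V_ZG G)" "(V_ZG G)\<lparr>carrier := H\<rparr> \<cong> C4xC2"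
  shows "\<exists>u :: int \<Rightarrow> int \<Rightarrow> 'a \<Rightarrow> int. (\<forall>i j. u i j \<in> group_ring_elems G \<and> augmentation G (u i j) = 1) \<and>
    (\<forall>i j i' j'. group_ring_mult G (u i j) (u i' j') = u (i + i') (j + j')) \<and>
    (\<forall>i j. u i j = group_ring_one G \<longleftrightarrow> 4 dvd i \<and> 2 dvd j)"
proof -
  obtain f where f: "f \<in> iso ((V_ZG G)\<lparr>carrier := H\<rparr>) C4xC2" using H(2) by (auto simp: is_iso_def)
  then have bij: "bij_betw f H (carrier C4xC2)" by (simp add: iso_def)
  have carr: "carrier C4xC2 = {0..<4} \<times> {0..<2}"
    by (simp add: C4xC2_def carrier_integer_mod_group)
  have units: "H \<subseteq> normalized_units G" using subgroup.subset[OF H(1)] by (simp add: V_ZG_def)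
  have closed: "group_ring_mult G v w \<in> H" if "v \<in> H" "w \<in> H" for v w
    using subgroup.m_closed[OF H(1) that] by (simp add: V_ZG_def)
  have one: "group_ring_one G \<in> H" using subgroup.one_closed[OF H(1)] by (simp add: V_ZG_def)
  have f_mult: "f (group_ring_mult G v w) = f v \<otimes>\<^bsub>C4xC2\<^esub> f w" if "v \<in> H" "w \<in> H" for v w
    using f that by (auto simp: iso_def hom_def V_ZG_def)
  define u where "u i j = inv_into H f (i mod 4, j mod 2)" for i j :: int
  have u: "u i j \<in> H" "f (u i j) = (i mod 4, j mod 2)" for i j
  proof -
    have "(i mod 4, j mod 2) \<in> f ` H" using bij by (simp add: bij_betw_def carr)
    then show "u i j \<in> H" "f (u i j) = (i mod 4, j mod 2)"
      unfolding u_def by (rule inv_into_into, rule f_inv_into_f)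
  qed
  have inj: "v = w" if "v \<in> H" "w \<in> H" "f v = f w" for v w
    using bij that by (auto simp: bij_betw_def inj_on_def)
  have mult: "group_ring_mult G (u i j) (u i' j') = u (i + i') (j + j')" for i j i' j'
  proof (rule inj)
    show "f (group_ring_mult G (u i j) (u i' j')) = f (u (i + i') (j + j'))"
      unfolding f_mult[OF u(1) u(1)] u(2) by (simp add: C4xC2_def mod_add_eq)
  qed (use u closed in auto)
  have u00: "group_ring_one G = u 0 0"
  proof (rule inj[OF one u(1)])
    obtain i j where ij: "f (group_ring_one G) = (i, j)" by (cases "f (group_ring_one G)")
    have "f (group_ring_one G) \<in> carrier C4xC2" using bij one by (auto simp: bij_betw_def)
    then have ranges: "0 \<le> i" "i < 4" "0 \<le> j" "j < 2" by (auto simp: carr ij)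
    have "group_ring_one G \<in> group_ring_elems G" using one units by (auto simp: normalized_units_def)
    \<comment> \<open>The image of the identity is idempotent in C4 x C2, and doubling fixes only
      (0, 0).\<close>
    then have "f (group_ring_one G) = f (group_ring_one G) \<otimes>\<^bsub>C4xC2\<^esub> f (group_ring_one G)"
      using f_mult[OF one one] group_ring_one_left[OF fin] by simp
    then have "i = (i + i) mod 4" "j = (j + j) mod 2" by (simp_all add: ij C4xC2_def)
    then have "i = 0" "j = 0" using ranges by presburger+
    then show "f (group_ring_one G) = f (u 0 0)" by (simp add: ij u(2))
  qed
  have "u i j = group_ring_one G \<longleftrightarrow> 4 dvd i \<and> 2 dvd j" for i j
  proof -
    have "u i j = u 0 0 \<longleftrightarrow> f (u i j) = f (u 0 0)" using inj[OF u(1) u(1), of i j 0 0] by metis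
    then show ?thesis unfolding u00 by (simp add: u(2) dvd_eq_mod_eq_0)
  qed
  moreover have "u i j \<in> group_ring_elems G \<and> augmentation G (u i j) = 1" for i j
    using u(1) units by (auto simp: normalized_units_def)
  ultimately show ?thesis using mult by blast
qed

end

section \<open>Traces on joint eigenspaces\<close>

text \<open>Multiplication by \<open>Y\<close> permutes the summands, so every power of
  \<open>Y\<close> fixes the sum; over a field of characteristic 0 it is \<open>n\<close> times the
  projection onto the fixed space of \<open>Y\<close>.\<close>

lemma geometric_sum_absorb:
  fixes Y :: "'r::ring_1"
  assumes "Y ^ n = 1"
  shows "(\<Sum>j<n. Y ^ j) * (\<Sum>j<n. Y ^ j) = of_nat n * (\<Sum>j<n. Y ^ j)"
proof -
  define p where "p = (\<Sum>j<n. Y ^ j)"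
  have "Y * p + 1 = p + Y ^ n"
    using sum.lessThan_Suc_shift[of "\<lambda>j. Y ^ j" n] sum.lessThan_Suc[of "\<lambda>j. Y ^ j" n]
    by (simp add: p_def sum_distrib_left add.commute)
  then have "Y * p = p" using assms by simp
  then have "Y ^ j * p = p" for j by (induction j) (simp_all add: mult.assoc)
  then have "p * p = (\<Sum>j<n. p)" by (subst p_def) (simp add: sum_distrib_right)
  then show ?thesis by (simp add: p_def)
qed

lemma geometric_sum_commute:
  fixes Y Z :: "'r::ring_1"
  assumes "Z * Y = Y * Z"
  shows "Z * (\<Sum>j<n. Y ^ j) = (\<Sum>j<n. Y ^ j) * Z"
  using power_commuting_commutes[OF assms [symmetric]]
  by (simp add: sum_distrib_left sum_distrib_right)

lemma scal_op_power:
  fixes F :: "('a, 'c::comm_ring_1) linop"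
  shows "(scal_op c * F) ^ j = scal_op (c ^ j) * F ^ j"
proof (induction j)
  case (Suc j)
  have "(scal_op c * F) ^ Suc j = scal_op c * (F * scal_op (c ^ j)) * F ^ j"
    by (simp add: Suc.IH mult.assoc)
  also have "\<dots> = (scal_op c * scal_op (c ^ j)) * F ^ Suc j"
    unfolding scal_op_commute[of F] by (simp only: mult.assoc power_Suc)
  finally show ?case by simp
qed simp

lemma product_of_commuting_scaled_idempotents:
  fixes P Q R :: "'r::ring_1"
  assumes "P * P = of_nat a * P" "Q * Q = of_nat b * Q" "R * R = of_nat c * R"
    and "Q * P = P * Q" "R * P = P * R" "R * Q = Q * R"
  shows "P * Q * R * (P * Q * R) = of_nat (a * b * c) * (P * Q * R)"
proof -
  have "P * Q * R * (P * Q * R) = P * Q * (R * P) * Q * R" by (simp only: mult.assoc)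
  also have "\<dots> = P * (Q * P) * (R * Q) * R" by (simp only: assms(5) mult.assoc)
  also have "\<dots> = (P * P) * (Q * Q) * (R * R)" by (simp only: assms(4,6) mult.assoc)
  also have "\<dots> = of_nat a * (P * of_nat b) * (Q * of_nat c) * R"
    by (simp only: assms(1-3) mult.assoc)
  also have "\<dots> = of_nat a * of_nat b * (P * of_nat c) * Q * R"
    unfolding mult_of_nat_commute[of b P, symmetric] mult_of_nat_commute[of c Q, symmetric]
    by (simp only: mult.assoc)
  also have "\<dots> = of_nat (a * b * c) * (P * Q * R)"
    unfolding mult_of_nat_commute[of c P, symmetric] by (simp only: mult.assoc of_nat_mult)
  finally show ?thesis .
qed

context group
begin

text \<open>The left hand side is the trace of \<open>8 * n\<close> times a projection: the one onto the common
  eigenspace of the commuting operators \<open>m \<mapsto> a m\<close>, \<open>m \<mapsto> b m\<close> and \<open>m \<mapsto> m c\<close> with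
  eigenvalues \<open>\<zeta>\<close>, \<open>1\<close> and \<open>\<omega>\<close> (up to inversion).\<close>

lemma character_sum:
  fixes u :: "int \<Rightarrow> int \<Rightarrow> 'a \<Rightarrow> int" and \<zeta> \<omega> :: complex
  assumes fin: "finite (carrier G)"
    and u_mult: "\<And>i j i' j'. group_ring_mult G (u i j) (u i' j') = u (i + i') (j + j')"
    and u_one: "u 0 0 = group_ring_one G" "u 4 0 = group_ring_one G" "u 0 2 = group_ring_one G"
    and c: "c \<in> carrier G" "c [^] n = \<one>" "n > (0::nat)"
    and roots: "\<zeta> ^ 4 = 1" "\<omega> ^ n = 1"
  shows "\<exists>N::nat. (\<Sum>m<n. \<omega> ^ m * (\<Sum>j<4. \<zeta> ^ j *
      of_int (conj_sum G (u (int j) 0) (c [^] m) + conj_sum G (u (int j) 1) (c [^] m)))) = of_nat (8 * n * N)"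
proof -
  define A B C :: "('a, complex) linop"
    where "A = left_op G (u 1 0)" and "B = left_op G (u 0 1)" and "C = right_op G c"
  have A_pow: "A ^ j = left_op G (u (int j) 0)" for j
    by (induction j) (simp_all add: A_def u_one left_op_one fin left_op_mult u_mult)
  have A4: "A ^ 4 = 1" unfolding A_pow by (simp add: u_one left_op_one fin)
  have BB: "B * B = 1" by (simp add: B_def left_op_mult u_mult u_one left_op_one fin)
  have C_pow: "C ^ m = right_op G (c [^] m)" for m unfolding C_def by (rule right_op_pow[OF c(1)])
  have Cn: "C ^ n = 1" unfolding C_pow c(2) by (rule right_op_one)
  have AB: "A * B = B * A" by (simp add: A_def B_def left_op_mult u_mult)
  have AC: "A * C = C * A" unfolding A_def C_def by (rule left_right_op_commute[OF c(1)])
  have BC: "B * C = C * B" unfolding B_def C_def by (rule left_right_op_commute[OF c(1)])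
  \<comment> \<open>Scaling moves the wanted eigenvalues of A and C to 1, so that the geometric sums
    of Y and Z project onto these eigenspaces.\<close>
  define Y Z where "Y = scal_op \<zeta> * A" and "Z = scal_op \<omega> * C"
  have Y4: "Y ^ 4 = 1" and Zn: "Z ^ n = 1"
    unfolding Y_def Z_def scal_op_power by (simp_all add: roots A4 Cn)
  have scal_comm: "scal_op s * F * (scal_op s' * F') = scal_op s' * F' * (scal_op s * F)"
    if "F * F' = F' * F" for s s' and F F' :: "('a, complex) linop"
  proof -
    have "scal_op s * F * (scal_op s' * F') = scal_op s * (F * scal_op s') * F'" by (simp only: mult.assoc)
    also have "\<dots> = (scal_op s * scal_op s') * (F * F')" unfolding scal_op_commute[of F] by (simp only: mult.assoc)
    also have "\<dots> = (scal_op s' * scal_op s) * (F' * F)" by (simp only: that scal_op_hom mult.commute[of s])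
    also have "\<dots> = scal_op s' * (scal_op s * F') * F" by (simp only: mult.assoc)
    also have "\<dots> = scal_op s' * (F' * scal_op s) * F" by (simp only: scal_op_commute[of F'])
    also have "\<dots> = scal_op s' * F' * (scal_op s * F)" by (simp only: mult.assoc)
    finally show ?thesis .
  qed
  have BY: "B * Y = Y * B" using scal_comm[of B A 1 \<zeta>] AB by (simp add: Y_def)
  have BZ: "B * Z = Z * B" using scal_comm[of B C 1 \<omega>] BC by (simp add: Z_def)
  have YZ: "Y * Z = Z * Y" unfolding Y_def Z_def by (rule scal_comm[OF AC])
  define P where "P = (\<Sum>j<4. Y ^ j)"
  define R where "R = (\<Sum>m<n. Z ^ m)"
  define Q where "Q = 1 + B"
  define F where "F = P * Q * R"
  have PP: "P * P = of_nat 4 * P" unfolding P_def by (rule geometric_sum_absorb[OF Y4])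
  have RR: "R * R = of_nat n * R" unfolding R_def by (rule geometric_sum_absorb[OF Zn])
  have QQ: "Q * Q = of_nat 2 * Q" by (simp add: Q_def distrib_left distrib_right BB mult_2)
  have "B * P = P * B" unfolding P_def by (rule geometric_sum_commute[OF BY])
  then have QP: "Q * P = P * Q" by (simp add: Q_def distrib_left distrib_right)
  have "B * R = R * B" unfolding R_def by (rule geometric_sum_commute[OF BZ])
  then have RQ: "R * Q = Q * R" by (simp add: Q_def distrib_left distrib_right)
  have "Y * R = R * Y" unfolding R_def by (rule geometric_sum_commute[OF YZ])
  then have RP: "R * P = P * R" unfolding P_def by (intro geometric_sum_commute) simp
  have FF: "F * F = of_nat (8 * n) * F"
    unfolding F_def product_of_commuting_scaled_idempotents[OF PP QQ RR QP RP RQ] by simp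
  have pres: "preserves (carrier G) F"
    by (simp add: F_def P_def Q_def R_def Y_def Z_def A_def B_def C_def)
  from tr_scaled_idempotent[OF fin pres _ FF] c(3) obtain N :: nat
    where N: "tr (carrier G) F = of_nat (8 * n * N)" by auto
  have "F = (\<Sum>j<4. \<Sum>m<n. Y ^ j * Q * Z ^ m)"
    unfolding F_def P_def R_def sum_distrib_left sum_distrib_right by (rule sum.swap)
  then have "tr (carrier G) F = (\<Sum>j<4. \<Sum>m<n. tr (carrier G) (Y ^ j * Q * Z ^ m))"
    by (simp add: tr_sum)
  also have "\<dots> = (\<Sum>j<4. \<Sum>m<n. \<zeta> ^ j * \<omega> ^ m *
      of_int (conj_sum G (u (int j) 0) (c [^] m) + conj_sum G (u (int j) 1) (c [^] m)))"
  proof (intro sum.cong refl)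
    fix j m
    have "Y ^ j * Q * Z ^ m = scal_op (\<zeta> ^ j) * (A ^ j * Q * scal_op (\<omega> ^ m)) * C ^ m"
      unfolding Y_def Z_def scal_op_power by (simp only: mult.assoc)
    also have "\<dots> = (scal_op (\<zeta> ^ j) * scal_op (\<omega> ^ m)) * (A ^ j * C ^ m + A ^ j * B * C ^ m)"
      unfolding scal_op_commute[of "A ^ j * Q"] by (simp only: Q_def mult.assoc distrib_left distrib_right mult_1_left)
    finally have *: "Y ^ j * Q * Z ^ m = scal_op (\<zeta> ^ j * \<omega> ^ m) * (A ^ j * C ^ m + A ^ j * B * C ^ m)"
      by simp
    have "A ^ j * B = left_op G (u (int j) 1)"
      unfolding A_pow B_def by (simp add: left_op_mult u_mult)
    then show "tr (carrier G) (Y ^ j * Q * Z ^ m) = \<zeta> ^ j * \<omega> ^ m *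
      of_int (conj_sum G (u (int j) 0) (c [^] m) + conj_sum G (u (int j) 1) (c [^] m))"
      unfolding * tr_scal tr_add by (simp add: A_pow C_pow tr_left_right_op fin c(1))
  qed
  also have "\<dots> = (\<Sum>m<n. \<omega> ^ m * (\<Sum>j<4. \<zeta> ^ j *
      of_int (conj_sum G (u (int j) 0) (c [^] m) + conj_sum G (u (int j) 1) (c [^] m))))"
    by (subst sum.swap) (simp add: sum_distrib_left mult_ac)
  finally show ?thesis using N by metis
qed

section \<open>The element c and the final congruence\<close>

text \<open>The exponents are bounded because 2^k is at most the order of \<open>G\<close>.
  Maximality is phrased with powers, the form that applies to an element whose order is not
  known.\<close>

lemma exists_max_two_power_order:
  assumes fin: "finite (carrier G)" and g: "g \<in> carrier G" "ord g = 4"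
  shows "\<exists>c\<in>carrier G. \<exists>k\<ge>2. ord c = 2 ^ k \<and>
    (\<forall>g\<in>carrier G. g [^] (2 ^ Suc k :: int) = \<one> \<longrightarrow> g [^] (2 ^ k :: int) = \<one>)"
proof -
  define S where "S = {k. \<exists>g\<in>carrier G. ord g = 2 ^ k}"
  have "S \<subseteq> {..order G}"
  proof
    fix k assume "k \<in> S"
    then obtain g where "g \<in> carrier G" "ord g = 2 ^ k" by (auto simp: S_def)
    then have "2 ^ k \<le> order G" using ord_le_group_order[OF fin] by metis
    then show "k \<in> {..order G}" using less_exp[of k] le_trans[of k "2 ^ k"] by simp
  qed
  then have finS: "finite S" using finite_subset by blast
  have "ord g = 2 ^ 2" using g(2) by simp
  then have "2 \<in> S" using g(1) by (auto simp: S_def)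
  define k where "k = Max S"
  have "k \<in> S" unfolding k_def using finS \<open>2 \<in> S\<close> by (intro Max_in) auto
  then obtain c where c: "c \<in> carrier G" "ord c = 2 ^ k" by (auto simp: S_def)
  have "h [^] (2 ^ k :: int) = \<one>" if h: "h \<in> carrier G" "h [^] (2 ^ Suc k :: int) = \<one>" for h
  proof -
    have "int (ord h) dvd int (2 ^ Suc k)" using h int_pow_eq_id[OF h(1), of "2 ^ Suc k"] by simp
    then have "ord h dvd 2 ^ Suc k" by (simp only: of_nat_dvd_iff)
    then obtain i where i: "ord h = 2 ^ i" by (metis divides_primepow_nat two_is_prime_nat)
    then have "i \<in> S" using h(1) by (auto simp: S_def)
    then have "i \<le> k" using finS by (simp add: k_def)
    then have "int (ord h) dvd 2 ^ k" by (simp add: i le_imp_power_dvd)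
    then show ?thesis using int_pow_eq_id[OF h(1)] by blast
  qed
  moreover have "2 \<le> k" using finS \<open>2 \<in> S\<close> by (simp add: k_def)
  ultimately show ?thesis using c by blast
qed

end

text \<open>Adding the two equations eliminates \<open>w\<close>.\<close>

lemma dvd_of_two_representations:
  fixes w :: int and N1 N2 d e :: nat
  assumes "of_int (int d + w) = (of_nat (e * N1) :: complex)"
    and "of_int (int d - w) = (of_nat (e * N2) :: complex)"
  shows "e dvd 2 * d"
proof -
  have "int d + w = int (e * N1)" using assms(1) by (metis of_int_eq_iff of_int_of_nat_eq)
  moreover have "int d - w = int (e * N2)" using assms(2) by (metis of_int_eq_iff of_int_of_nat_eq)
  ultimately have "int (2 * d) = int (e * (N1 + N2))" by (simp add: distrib_left)
  then have "2 * d = e * (N1 + N2)" by (simp only: of_nat_eq_iff)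
  then show ?thesis by (rule dvdI)
qed

theorem theorem1p1:
  fixes G :: "('a, 'b) monoid_scheme"
  assumes "group G" and "finite (carrier G)"
    and "\<exists>H. subgroup H (V_ZG G) \<and> (V_ZG G)\<lparr>carrier := H\<rparr> \<cong> C4xC2"
  shows "\<exists>K. subgroup K G \<and> G\<lparr>carrier := K\<rparr> \<cong> C4xC2"
proof (rule ccontr)
  assume contra: "\<not> ?thesis"
  interpret group G by fact
  note fin = assms(2)
  have no: "t = x \<otimes>\<^bsub>G\<^esub> x" if "x \<in> carrier G" "t \<in> carrier G" "x \<otimes>\<^bsub>G\<^esub> t = t \<otimes>\<^bsub>G\<^esub> x" "ord x = 4" "ord t = 2" for x t
    using C4xC2_subgroupI[of x t] that contra by blast
  obtain H where H: "subgroup H (V_ZG G)" "(V_ZG G)\<lparr>carrier := H\<rparr> \<cong> C4xC2" using assms(3) by blast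
  obtain u :: "int \<Rightarrow> int \<Rightarrow> 'a \<Rightarrow> int" where
    u_elems: "\<And>i j. u i j \<in> group_ring_elems G" "\<And>i j. augmentation G (u i j) = 1" and
    u_mult: "\<And>i j i' j'. group_ring_mult G (u i j) (u i' j') = u (i + i') (j + j')" and
    u_one: "\<And>i j. u i j = group_ring_one G \<longleftrightarrow> 4 dvd i \<and> 2 dvd j"
    using C4xC2_units[OF fin H] by metis
  \<comment> \<open>An element of order 4 makes k at least 2, so that c has powers of order
    4.\<close>
  have "\<exists>g\<in>carrier G. (g \<otimes>\<^bsub>G\<^esub> g) \<otimes>\<^bsub>G\<^esub> (g \<otimes>\<^bsub>G\<^esub> g) = \<one>\<^bsub>G\<^esub> \<and> g \<otimes>\<^bsub>G\<^esub> g \<noteq> \<one>\<^bsub>G\<^esub>"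
    by (rule exists_fourth_root_of_one[OF fin, of "u 2 0" "u 1 0"]) (simp_all add: u_elems u_mult u_one)
  then obtain g where g: "g \<in> carrier G" "(g \<otimes>\<^bsub>G\<^esub> g) \<otimes>\<^bsub>G\<^esub> (g \<otimes>\<^bsub>G\<^esub> g) = \<one>\<^bsub>G\<^esub>" "g \<otimes>\<^bsub>G\<^esub> g \<noteq> \<one>\<^bsub>G\<^esub>"
    by blast
  have g2: "g [^]\<^bsub>G\<^esub> (2::int) = g \<otimes>\<^bsub>G\<^esub> g" using g(1) int_pow_mult[of g 1 1] by simp
  have "g [^]\<^bsub>G\<^esub> (4::int) = \<one>\<^bsub>G\<^esub>" using g(1,2) int_pow_mult[of g 2 2] by (simp add: g2)
  then have "ord g = 4" using g by (intro ord_eq_4) (simp_all add: g2)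
  from exists_max_two_power_order[OF fin g(1) this] obtain c k where
    c: "c \<in> carrier G" "ord c = 2 ^ k" "2 \<le> k" and
    max: "\<And>g. g \<in> carrier G \<Longrightarrow> g [^]\<^bsub>G\<^esub> (2 ^ Suc k :: int) = \<one>\<^bsub>G\<^esub> \<Longrightarrow> g [^]\<^bsub>G\<^esub> (2 ^ k :: int) = \<one>\<^bsub>G\<^esub>"
    by blast
  define q :: nat where "q = 2 ^ (k - 2)"
  have q: "q > 0" "2 ^ k = 4 * q"
  proof -
    obtain l where "k = 2 + l" using c(3) le_Suc_ex by blast
    then show "q > 0" "2 ^ k = 4 * q" by (simp_all add: q_def)
  qed
  \<comment> \<open>a^i and a^i b are taken together because 1 + b is twice the projection onto the
    eigenvalue 1 of b.\<close>
  define T where "T i m = conj_sum G (u i 0) (c [^]\<^bsub>G\<^esub> m) + conj_sum G (u i 1) (c [^]\<^bsub>G\<^esub> m)" for i :: int and m :: nat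
  have pow_one_iff: "c [^]\<^bsub>G\<^esub> m = \<one>\<^bsub>G\<^esub> \<longleftrightarrow> 4 * q dvd m" for m :: nat
    using pow_eq_id[OF c(1), of m] by (simp add: c(2) q(2))
  have u_pow: "left_op G (u i j) ^ r = left_op G (u (int r * i) (int r * j))" for i j and r :: nat
  proof (induction r)
    case 0
    then show ?case using left_op_one[OF fin] u_one[of 0 0] by simp
  next
    case (Suc r)
    then show ?case by (simp add: left_op_mult u_mult algebra_simps)
  qed
  have vanish: "conj_sum G (u i j) (c [^]\<^bsub>G\<^esub> m) = 0"
    if i: "4 dvd 2 ^ s * i" "2 dvd 2 ^ s * j" and m: "\<not> 2 ^ k dvd 2 ^ s * m" for i j :: int and s m :: nat
  proof (rule conj_sum_eq_0[OF fin])
    show "(left_op G (u i j) :: ('a, int) linop) ^ 2 ^ s = 1"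
      unfolding u_pow using u_one[of "2 ^ s * i" "2 ^ s * j"] i left_op_one[OF fin] by simp
    show "c [^]\<^bsub>G\<^esub> m \<in> carrier G" using c(1) by simp
    have "ord (c [^]\<^bsub>G\<^esub> m) dvd 2 ^ k"
    proof -
      have "(c [^]\<^bsub>G\<^esub> m) [^]\<^bsub>G\<^esub> ((2::nat) ^ k) = \<one>\<^bsub>G\<^esub>"
        using c(1) pow_eq_id[OF c(1), of "m * 2 ^ k"] by (simp add: nat_pow_pow c(2))
      then show ?thesis using pow_eq_id c(1) by simp
    qed
    then obtain r where r: "ord (c [^]\<^bsub>G\<^esub> m) = 2 ^ r" by (metis divides_primepow_nat two_is_prime_nat)
    have "\<not> r \<le> s"
    proof
      assume "r \<le> s"
      then have "ord (c [^]\<^bsub>G\<^esub> m) dvd 2 ^ s" by (simp add: r le_imp_power_dvd)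
      then have "(c [^]\<^bsub>G\<^esub> m) [^]\<^bsub>G\<^esub> ((2::nat) ^ s) = \<one>\<^bsub>G\<^esub>" using pow_eq_id c(1) by simp
      then have "c [^]\<^bsub>G\<^esub> (m * 2 ^ s) = \<one>\<^bsub>G\<^esub>" using c(1) by (simp add: nat_pow_pow)
      then show False using m pow_eq_id[OF c(1)] by (simp add: c(2) mult.commute)
    qed
    then show "2 ^ Suc s dvd ord (c [^]\<^bsub>G\<^esub> m)" unfolding r by (intro le_imp_power_dvd) simp
  qed
  \<comment> \<open>Even powers of a, with or without b, have order at most 2, so only c^m of order
    at most 2 counts, that is 2 q dvd m. Odd powers of a have order 4, which leaves q dvd m.\<close>
  have T_even: "T 0 m = 0" "T 2 m = 0" if "\<not> 2 * q dvd m" for m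
    using vanish[of 1 _ _ m] that by (simp_all add: T_def q(2))
  have T_odd: "T 1 m = 0" "T 3 m = 0" if "\<not> q dvd m" for m
    using vanish[of 2 _ _ m] that by (simp_all add: T_def q(2))
  \<comment> \<open>b, a^2 and a^2 b are involutions and have coefficient 0 at the identity, so only
    the trivial unit contributes.\<close>
  have T_id: "T 0 0 = int (order G)" "T 2 0 = 0"
  proof -
    have inv_one: "u i j \<one>\<^bsub>G\<^esub> = 0" if "4 dvd 2 * i" "\<not> (4 dvd i \<and> 2 dvd j)" for i j
      by (rule involution_coeff_one[OF fin u_elems]) (use that in \<open>simp_all add: u_mult u_one\<close>)
    have "u 0 0 = group_ring_one G" using u_one by simp
    then show "T 0 0 = int (order G)"
      using inv_one[of 0 1] by (simp add: T_def conj_sum_one group_ring_one_def)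
    show "T 2 0 = 0" using inv_one[of 2 0] inv_one[of 2 1] by (simp add: T_def conj_sum_one)
  qed
  define w where "w = T 0 (2 * q) - T 2 (2 * q)"
  define Ev Od :: "complex \<Rightarrow> complex"
    where "Ev \<omega> = (\<Sum>m<4 * q. \<omega> ^ m * of_int (T 0 m - T 2 m))"
      and "Od \<omega> = (\<Sum>m<4 * q. \<omega> ^ m * of_int (T 1 m - T 3 m))" for \<omega>
  have Ev: "Ev \<omega> = of_nat (order G) + \<omega> ^ (2 * q) * of_int w" for \<omega>
  proof -
    have "Ev \<omega> = (\<Sum>m\<in>{0, 2 * q}. \<omega> ^ m * of_int (T 0 m - T 2 m))"
      unfolding Ev_def
    proof (rule sum.mono_neutral_right)
      show "\<forall>m\<in>{..<4 * q} - {0, 2 * q}. \<omega> ^ m * of_int (T 0 m - T 2 m) = 0"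
      proof
        fix m assume m: "m \<in> {..<4 * q} - {0, 2 * q}"
        have "\<not> 2 * q dvd m"
        proof
          assume "2 * q dvd m"
          then obtain d where d: "m = 2 * q * d" by blast
          then have "d < 2" using m q(1) by (simp add: mult.commute)
          then show False using d m by (auto simp: less_2_cases_iff)
        qed
        then show "\<omega> ^ m * of_int (T 0 m - T 2 m) = 0" by (simp add: T_even)
      qed
    qed (use q(1) in auto)
    then show ?thesis using q(1) by (simp add: T_id w_def)
  qed
  have Od: "Od \<omega> = of_int (T 1 0 - T 3 0) + \<omega> ^ q * of_int (T 1 q - T 3 q)
      + (\<omega> ^ q) ^ 2 * of_int (T 1 (2 * q) - T 3 (2 * q)) + (\<omega> ^ q) ^ 3 * of_int (T 1 (3 * q) - T 3 (3 * q))" for \<omega>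
  proof -
    have "Od \<omega> = (\<Sum>m\<in>{0, q, 2 * q, 3 * q}. \<omega> ^ m * of_int (T 1 m - T 3 m))"
      unfolding Od_def
    proof (rule sum.mono_neutral_right)
      show "\<forall>m\<in>{..<4 * q} - {0, q, 2 * q, 3 * q}. \<omega> ^ m * of_int (T 1 m - T 3 m) = 0"
      proof
        fix m assume m: "m \<in> {..<4 * q} - {0, q, 2 * q, 3 * q}"
        have "\<not> q dvd m"
        proof
          assume "q dvd m"
          then obtain d where d: "m = q * d" by blast
          then have "d < 4" using m q(1) by (simp add: mult.commute)
          then have "d = 0 \<or> d = 1 \<or> d = 2 \<or> d = 3" by auto
          then show False using d m by auto
        qed
        then show "\<omega> ^ m * of_int (T 1 m - T 3 m) = 0" by (simp add: T_odd)
      qed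
    qed (use q(1) in auto)
    then show ?thesis using q(1) by (simp add: power_mult [symmetric] mult.commute)
  qed
  \<comment> \<open>An eigenvalue \<open>\<zeta>\<close> with square -1 gives a^2 the sign -1. This
    splits the trace into the even powers of a, \<open>Ev\<close>, and \<open>\<zeta>\<close> times
    the odd ones, \<open>Od\<close>; the factor 8 (4 q) is 8 times 2^k.\<close>
  have sums: "\<exists>N::nat. Ev \<omega> + \<zeta> * Od \<omega> = of_nat (8 * (4 * q) * N)"
    if "\<omega> ^ (4 * q) = 1" "\<zeta> ^ 2 = - 1" for \<omega> \<zeta> :: complex
  proof -
    have \<zeta>: "\<zeta> ^ 4 = 1" "\<zeta> ^ 3 = - \<zeta>"
      using that(2) power_mult[of \<zeta> 2 2] by (simp_all add: power3_eq_cube power2_eq_square)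
    have u_ones: "u 0 0 = group_ring_one G" "u 4 0 = group_ring_one G" "u 0 2 = group_ring_one G"
      by (simp_all add: u_one)
    have "c [^]\<^bsub>G\<^esub> (4 * q) = \<one>\<^bsub>G\<^esub>" by (simp add: pow_one_iff)
    from character_sum[OF fin u_mult u_ones c(1) this _ \<zeta>(1) that(1)] q(1) obtain N :: nat where
      N: "(\<Sum>m<4 * q. \<omega> ^ m * (\<Sum>j<4. \<zeta> ^ j * of_int (T (int j) m))) = of_nat (8 * (4 * q) * N)"
      unfolding T_def by auto
    have inner: "(\<Sum>j<4. \<zeta> ^ j * of_int (T (int j) m))
        = of_int (T 0 m - T 2 m) + \<zeta> * of_int (T 1 m - T 3 m)" for m
      using that(2) \<zeta>(2) by (simp add: eval_nat_numeral(2-3) lessThan_Suc algebra_simps)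
    have "Ev \<omega> + \<zeta> * Od \<omega> = (\<Sum>m<4 * q. \<omega> ^ m * (\<Sum>j<4. \<zeta> ^ j * of_int (T (int j) m)))"
      unfolding inner Ev_def Od_def sum_distrib_left [of \<zeta>] sum.distrib [symmetric]
      by (rule sum.cong) (simp_all add: distrib_left mult.left_commute)
    then show ?thesis using N by metis
  qed
  \<comment> \<open>A primitive root of unity of order 4 q: its power 2 q is -1, which turns |G| +
    w, the value of \<open>Ev\<close> at 1, into |G| - w.\<close>
  define \<omega> where "\<omega> = cis (pi / 2 / real q)"
  have \<omega>q: "\<omega> ^ q = \<i>" using q(1) by (simp add: \<omega>_def DeMoivre)
  have \<omega>2q: "\<omega> ^ (2 * q) = - 1" using \<omega>q power_mult[of \<omega> q 2] by (simp add: mult.commute)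
  have \<omega>4q: "\<omega> ^ (4 * q) = 1" using \<omega>q power_mult[of \<omega> q 4] by (simp add: mult.commute)
  have E1: "Ev 1 = of_int (int (order G) + w)" and Ev\<omega>: "Ev \<omega> = of_int (int (order G) - w)"
    by (simp_all add: Ev \<omega>2q)
  from cyclic_subgroup_small_index[OF fin no c max] show False
  proof
    assume odd_index: "\<not> 2 ^ Suc k dvd order G"
    \<comment> \<open>Adding the cases \<zeta> = i and \<zeta> = -i cancels \<open>Od\<close> and
      doubles \<open>Ev\<close>, so half of the factor 8 (4 q) survives. Both values of \<omega>
      together then give that 2^(k+1) divides |G|.\<close>
    have double: "\<exists>N::nat. Ev \<omega>' = of_nat (4 * (4 * q) * N)" if root: "\<omega>' ^ (4 * q) = 1" for \<omega>'
    proof -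
      obtain N1 :: nat where "Ev \<omega>' + \<i> * Od \<omega>' = of_nat (8 * (4 * q) * N1)"
        using sums[OF root, of \<i>] by (auto simp only: power2_i)
      moreover obtain N2 :: nat where "Ev \<omega>' + (- \<i>) * Od \<omega>' = of_nat (8 * (4 * q) * N2)"
        using sums[OF root, of "- \<i>"] by (auto simp only: power2_minus power2_i)
      ultimately have "Ev \<omega>' + \<i> * Od \<omega>' + (Ev \<omega>' + (- \<i>) * Od \<omega>')
          = of_nat (8 * (4 * q) * N1) + of_nat (8 * (4 * q) * N2)" by (simp only:)
      then have "2 * Ev \<omega>' = 2 * of_nat (4 * (4 * q) * (N1 + N2))" by (simp add: algebra_simps)
      then show ?thesis by (metis mult_cancel_left zero_neq_numeral)
    qed
    obtain N1 N2 :: nat where "Ev 1 = of_nat (4 * (4 * q) * N1)" "Ev \<omega> = of_nat (4 * (4 * q) * N2)"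
      using double[of 1] double[OF \<omega>4q] by auto
    from dvd_of_two_representations[OF this[unfolded E1 Ev\<omega>]] have "2 * (4 * q) dvd order G"
      by simp
    then show False using odd_index by (simp add: q(2))
  next
    assume "(\<exists>g\<in>carrier G. \<exists>j::int. g \<otimes>\<^bsub>G\<^esub> c = c [^]\<^bsub>G\<^esub> j \<otimes>\<^bsub>G\<^esub> g \<and> 4 dvd j - 3) \<and> \<not> 2 ^ Suc (Suc k) dvd order G"
    then obtain g j where g: "g \<in> carrier G" "g \<otimes>\<^bsub>G\<^esub> c = c [^]\<^bsub>G\<^esub> (j::int) \<otimes>\<^bsub>G\<^esub> g" "4 dvd j - 3"
      and index: "\<not> 2 ^ Suc (Suc k) dvd order G" by blast
    \<comment> \<open>Conjugation by g acts with exponent j = 3 mod 4, so it sends c^q, of order 4,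
      to its inverse c^(3 q).\<close>
    have "c [^]\<^bsub>G\<^esub> (3 * q) = g \<otimes>\<^bsub>G\<^esub> c [^]\<^bsub>G\<^esub> q \<otimes>\<^bsub>G\<^esub> inv\<^bsub>G\<^esub> g"
    proof -
      have "g \<otimes>\<^bsub>G\<^esub> c [^]\<^bsub>G\<^esub> int q = c [^]\<^bsub>G\<^esub> (j * int q) \<otimes>\<^bsub>G\<^esub> g"
        by (rule twist_int_pow[OF c(1) g(1,2)])
      also have "c [^]\<^bsub>G\<^esub> (j * int q) = c [^]\<^bsub>G\<^esub> int (3 * q)"
      proof -
        obtain p where p: "j = 3 + 4 * p" using g(3) by (metis dvdE add.commute diff_add_cancel)
        have "int (3 * q) - j * int q = int (4 * q) * (- p)" by (simp add: p algebra_simps)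
        then show ?thesis using int_pow_eq[OF c(1)] by (simp only: c(2) q(2) dvd_triv_left)
      qed
      finally have "g \<otimes>\<^bsub>G\<^esub> c [^]\<^bsub>G\<^esub> q = c [^]\<^bsub>G\<^esub> (3 * q) \<otimes>\<^bsub>G\<^esub> g" by (simp only: int_pow_int)
      then show ?thesis using g(1) c(1) by (simp add: m_assoc)
    qed
    then have "conj_sum G v (c [^]\<^bsub>G\<^esub> (3 * q)) = conj_sum G v (c [^]\<^bsub>G\<^esub> q)" for v
      using conj_sum_conj[OF _ g(1)] c(1) by simp
    then have T3: "T i (3 * q) = T i q" for i by (simp add: T_def)
    have O1: "Im (Od 1) = 0" by (simp add: Od)
    \<comment> \<open>The terms at q and 3 q carry i and -i with equal integers and cancel; the
      others are real.\<close>
    have Od\<omega>: "Im (Od \<omega>) = 0" by (simp add: Od \<omega>q T3 power3_eq_cube)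
    \<comment> \<open>With \<open>Od\<close> and \<open>Ev\<close> real, i times \<open>Od\<close>
      is the imaginary part of a natural number and vanishes. \<open>Ev\<close> keeps the full
      factor 8 (4 q), which gives that 2^(k+2) divides |G|.\<close>
    have real: "\<exists>N::nat. Ev \<omega>' = of_nat (8 * (4 * q) * N)"
      if root: "\<omega>' ^ (4 * q) = 1" and im: "Im (Od \<omega>') = 0" "Im (Ev \<omega>') = 0" for \<omega>'
    proof -
      obtain N :: nat where N: "Ev \<omega>' + \<i> * Od \<omega>' = of_nat (8 * (4 * q) * N)"
        using sums[OF root, of \<i>] by (auto simp only: power2_i)
      have "Im (Ev \<omega>' + \<i> * Od \<omega>') = 0" unfolding N by simp
      then have "Od \<omega>' = 0" using im by (simp add: complex_eq_iff)
      then show ?thesis using N by auto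
    qed
    obtain N1 N2 :: nat where "Ev 1 = of_nat (8 * (4 * q) * N1)" "Ev \<omega> = of_nat (8 * (4 * q) * N2)"
      using real[of 1] real[OF \<omega>4q] O1 Od\<omega> E1 Ev\<omega> by auto
    from dvd_of_two_representations[OF this[unfolded E1 Ev\<omega>]] have "4 * (4 * q) dvd order G"
      by simp
    then show False using index by (simp add: q(2))
  qed
qed

end
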